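(* Let $(Q,c)$ be a gentle string algebra with coloring $c$, $\beta\in\mathbb N^{Q_0}$ a dimension vector, $r$ a maximal rank map for $\beta$, and $\epsilon$ a sign function on $(Q,c)$. If the up-and-down graph $\Gamma_{Q,c}(\beta,r,\epsilon)$ has no bands (i.e. it consists only of strings), then the $\operatorname{GL}(\beta)$-orbit of the associated (unique) up-and-down module $M$ is Zariski open in $\operatorname{Rep}_{Q,c}(\beta,r)$.
   Context: $\Bbbk$ is an algebraically closed field. $Q=(Q_0,Q_1)$ is a finite quiver, not assumed acyclic; $ta$, $ha$ denote tail and head of an arrow $a$. A path is a sequence of arrows $a_s\cdots a_1$ with $ha_i=ta_{i+1}$. Gentle string algebra: a finite-dimensional algebra of the form $\Bbbk Q/I$ such that (i) each vertex is the head of at most two arrows and the tail of at most two arrows; (ii) for each arrow $b$ there is at most one arrow $a$ with $ta=hb$ and $ab\notin I$, and at most one arrow $d$ with $hd=tb$ and $bd\notin I$; (iii) for each arrow $b$ there is at most one arrow $a$ with $ta=hb$ and $ab\in I$, and at most one arrow $d$ with $hd=tb$ and $bd\in I$; (iv) $I$ is generated by paths of length 2. Coloring: a map $c:Q_1\to S$, $S$ a finite set (of colors), such that $c^{-1}(s)$ is a directed path for each $s\in S$. Put $I_c=\langle ba \mid ha=tb,\ c(a)=c(b)\rangle$. "$(Q,c)$ is a gentle string algebra" means that $\Bbbk Q/I_c$ is one. Rank map for $\beta$: a map $r:Q_1\to\mathbb N$ with $r(a)\le\min(\beta_{ta},\beta_{ha})$ for all $a$, and $r(a_1)+r(a_2)\le\beta_{ha_1}$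 for each path $a_2a_1$ with $c(a_1)=c(a_2)$. It is maximal if it is maximal among rank maps for $\beta$ for the pointwise order. $\operatorname{Rep}_{Q,c}(\beta,r)$ is the set of tuples $(V_a)_a\in\prod_{a\in Q_1}\operatorname{Hom}_{\Bbbk}(\Bbbk^{\beta_{ta}},\Bbbk^{\beta_{ha}})$ satisfying the relations in $I_c$ and $\operatorname{rank}V_a\le r(a)$ for all $a$. $\operatorname{GL}(\beta)=\prod_{x\in Q_0}\operatorname{GL}(\beta_x)$ acts on it by base change. Sign function: let $\mathfrak X\subset Q_0\times S$ be the set of pairs $(x,s)$ such that some arrow of color $s$ is incident to $x$. A sign function is a map $\epsilon:\mathfrak X\to\{\pm1\}$ with $\epsilon(x,s_1)=-\epsilon(x,s_2)$ whenever $(x,s_1)\ne(x,s_2)$ are in $\mathfrak X$. Up-and-down graph $\Gamma_{Q,c}(\beta,r,\epsilon)$: the graph with vertices $v_i^x$, $x\in Q_0$, $1\le i\le\beta_x$, and, for each arrow $a$ and each $i=1,\dots,r(a)$, one edge, labeled $a$: $v_i^{ta} - v_i^{ha}$ if $\epsilon(ta,c(a))=1,\ \epsilon(ha,c(a))=-1$; $v_i^{ta} - v_{\beta_{ha}-i+1}^{ha}$ if $\epsilon(ta,c(a))=\epsilon(ha,c(a))=1$; $v_{\beta_{ta}-i+1}^{ta} - v_i^{ha}$ if $\epsilon(ta,c(a))=\epsilon(ha,c(a))=-1$; $v_{\beta_{ta}-i+1}^{ta} - v_{\beta_{ha}-i+1}^{ha}$ if $\epsilon(ta,c(a))=-1,\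 \epsilon(ha,c(a))=1$. Every vertex lies in at most two edges, so each connected component is a string (a path graph, possibly a single vertex) or a band (a cycle). Up-and-down module when there are no bands: $M$ has $M_x$ with basis $e_1^x,\dots,e_{\beta_x}^x$, and for each arrow $a$, $M_a(e_j^{ta})=e_k^{ha}$ if $v_j^{ta}$ and $v_k^{ha}$ are joined by an edge labeled $a$, and $M_a(e_j^{ta})=0$ if there is no such edge. *)

theory Defs
  imports
    "HOL-Computational_Algebra.Polynomial"
    "HOL-Library.Poly_Mapping"
    "HOL-Library.FuncSet"
    "Graph_Theory.Graph_Theory"
    "Jordan_Normal_Form.DL_Rank"
    "Jordan_Normal_Form.Gauss_Jordan_Elimination"
begin

section \<open>The path algebra\<close>

text \<open>
  A quiver is a finite directed multigraph (\<^locale>\<open>fin_digraph\<close>; loops and parallel arrows are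
  allowed). A path \<open>a\<^sub>s\<cdots>a\<^sub>1\<close> starting at \<open>x\<close> is encoded as \<open>(x, [a\<^sub>1, \<dots>, a\<^sub>s])\<close>, i.e. the arrows
  are listed in the order of traversal; \<open>(x, [])\<close> is the trivial path at \<open>x\<close>.
  Elements of the path algebra are finitely supported functions on paths.
\<close>

type_synonym ('v, 'a, 'k) path_alg = "('v \<times> 'a list) \<Rightarrow>\<^sub>0 'k"

definition paths :: "('v, 'a) pre_digraph \<Rightarrow> ('v \<times> 'a list) set" where
  "paths Q = {(x, p). \<exists>y. pre_digraph.awalk Q x p y}"

abbreviation path_end :: "('v, 'a) pre_digraph \<Rightarrow> 'v \<times> 'a list \<Rightarrow> 'v" where
  "path_end Q p \<equiv> pre_digraph.awlast Q (fst p) (snd p)"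

definition path_alg_carrier ::
    "('v, 'a) pre_digraph \<Rightarrow> ('v, 'a, 'k::comm_ring_1) path_alg set" where
  "path_alg_carrier Q = {f. Poly_Mapping.keys f \<subseteq> paths Q}"

text \<open>The product \<open>p \<cdot> q\<close> of two paths is ``first \<open>q\<close>, then \<open>p\<close>'', and zero if this is not possible.\<close>

definition path_alg_mult ::
    "('v, 'a) pre_digraph \<Rightarrow> ('v, 'a, 'k::comm_ring_1) path_alg \<Rightarrow> ('v, 'a, 'k) path_alg
      \<Rightarrow> ('v, 'a, 'k) path_alg" where
  "path_alg_mult Q f g =
    (\<Sum>p\<in>Poly_Mapping.keys f. \<Sum>q\<in>Poly_Mapping.keys g.
      if path_end Q q = fst p
      then Poly_Mapping.single (fst q, snd q @ snd p)
             (Poly_Mapping.lookup f p * Poly_Mapping.lookup g q)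
      else 0)"

text \<open>\<open>path2 Q a b\<close> is the path \<open>ba\<close> of length 2 (first \<open>a\<close>, then \<open>b\<close>).\<close>

definition path2 :: "('v, 'a) pre_digraph \<Rightarrow> 'a \<Rightarrow> 'a \<Rightarrow> ('v, 'a, 'k::comm_ring_1) path_alg" where
  "path2 Q a b = Poly_Mapping.single (tail Q a, [a, b]) 1"

definition paths2 :: "('v, 'a) pre_digraph \<Rightarrow> ('v, 'a, 'k::comm_ring_1) path_alg set" where
  "paths2 Q = {path2 Q a b | a b. a \<in> arcs Q \<and> b \<in> arcs Q \<and> head Q a = tail Q b}"

text \<open>
  The two-sided ideal of the path algebra generated by \<open>R\<close>. Closure under scalars and negation is
  covered by multiplication with scalar multiples of the unit (the sum of the trivial paths).
\<close>

inductive_set path_ideal ::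
    "('v, 'a) pre_digraph \<Rightarrow> ('v, 'a, 'k::comm_ring_1) path_alg set \<Rightarrow> ('v, 'a, 'k) path_alg set"
  for Q R where
  gen: "f \<in> R \<Longrightarrow> f \<in> path_ideal Q R"
| zero: "0 \<in> path_ideal Q R"
| add: "f \<in> path_ideal Q R \<Longrightarrow> g \<in> path_ideal Q R \<Longrightarrow> f + g \<in> path_ideal Q R"
| mult_left: "f \<in> path_ideal Q R \<Longrightarrow> h \<in> path_alg_carrier Q \<Longrightarrow>
    path_alg_mult Q h f \<in> path_ideal Q R"
| mult_right: "f \<in> path_ideal Q R \<Longrightarrow> h \<in> path_alg_carrier Q \<Longrightarrow>
    path_alg_mult Q f h \<in> path_ideal Q R"

text \<open>The quotient of the path algebra by \<open>I\<close> is spanned by the classes of finitely many elements.\<close>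

definition fin_dim_quotient ::
    "('v, 'a) pre_digraph \<Rightarrow> ('v, 'a, 'k::field) path_alg set \<Rightarrow> bool" where
  "fin_dim_quotient Q I \<longleftrightarrow>
    (\<exists>B. finite B \<and> B \<subseteq> path_alg_carrier Q \<and>
      (\<forall>f\<in>path_alg_carrier Q. \<exists>l. f - (\<Sum>b\<in>B. Poly_Mapping.map ((*) (l b)) b) \<in> I))"


section \<open>Gentle string algebras and colorings\<close>

definition gentle_string_algebra ::
    "('v, 'a) pre_digraph \<Rightarrow> ('v, 'a, 'k::field) path_alg set \<Rightarrow> bool" where
  "gentle_string_algebra Q I \<longleftrightarrow>
    fin_dim_quotient Q I \<and>
    (\<forall>x\<in>verts Q. card (in_arcs Q x) \<le> 2 \<and> card (out_arcs Q x) \<le> 2) \<and>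
    (\<forall>b\<in>arcs Q.
      (\<exists>\<^sub>\<le>\<^sub>1a. a \<in> arcs Q \<and> tail Q a = head Q b \<and> path2 Q b a \<notin> I) \<and>
      (\<exists>\<^sub>\<le>\<^sub>1d. d \<in> arcs Q \<and> head Q d = tail Q b \<and> path2 Q d b \<notin> I)) \<and>
    (\<forall>b\<in>arcs Q.
      (\<exists>\<^sub>\<le>\<^sub>1a. a \<in> arcs Q \<and> tail Q a = head Q b \<and> path2 Q b a \<in> I) \<and>
      (\<exists>\<^sub>\<le>\<^sub>1d. d \<in> arcs Q \<and> head Q d = tail Q b \<and> path2 Q d b \<in> I)) \<and>
    (\<exists>R\<subseteq>paths2 Q. I = path_ideal Q R)"

definition coloring :: "('v, 'a) pre_digraph \<Rightarrow> 's set \<Rightarrow> ('a \<Rightarrow> 's) \<Rightarrow> bool" where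
  "coloring Q S c \<longleftrightarrow>
    finite S \<and> c \<in> arcs Q \<rightarrow> S \<and>
    (\<forall>s\<in>S. \<exists>x p y. pre_digraph.awalk Q x p y \<and> set p = {a \<in> arcs Q. c a = s})"

definition color_ideal ::
    "('v, 'a) pre_digraph \<Rightarrow> ('a \<Rightarrow> 's) \<Rightarrow> ('v, 'a, 'k::comm_ring_1) path_alg set" where
  "color_ideal Q c = path_ideal Q
    {path2 Q a b | a b. a \<in> arcs Q \<and> b \<in> arcs Q \<and> head Q a = tail Q b \<and> c a = c b}"


section \<open>Representation spaces\<close>

definition rank_map ::
    "('v, 'a) pre_digraph \<Rightarrow> ('a \<Rightarrow> 's) \<Rightarrow> ('v \<Rightarrow> nat) \<Rightarrow> ('a \<Rightarrow> nat) \<Rightarrow> bool" where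
  "rank_map Q c \<beta> r \<longleftrightarrow>
    (\<forall>a\<in>arcs Q. r a \<le> min (\<beta> (tail Q a)) (\<beta> (head Q a))) \<and>
    (\<forall>a1\<in>arcs Q. \<forall>a2\<in>arcs Q. head Q a1 = tail Q a2 \<and> c a1 = c a2 \<longrightarrow>
      r a1 + r a2 \<le> \<beta> (head Q a1))"

definition maximal_rank_map ::
    "('v, 'a) pre_digraph \<Rightarrow> ('a \<Rightarrow> 's) \<Rightarrow> ('v \<Rightarrow> nat) \<Rightarrow> ('a \<Rightarrow> nat) \<Rightarrow> bool" where
  "maximal_rank_map Q c \<beta> r \<longleftrightarrow>
    rank_map Q c \<beta> r \<and>
    (\<forall>r'. rank_map Q c \<beta> r' \<and> (\<forall>a\<in>arcs Q. r a \<le> r' a) \<longrightarrow> (\<forall>a\<in>arcs Q. r' a = r a))"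

definition rep_tuples ::
    "('v, 'a) pre_digraph \<Rightarrow> ('v \<Rightarrow> nat) \<Rightarrow> ('a \<Rightarrow> 'k::field mat) set" where
  "rep_tuples Q \<beta> = (\<Pi>\<^sub>E a\<in>arcs Q. carrier_mat (\<beta> (head Q a)) (\<beta> (tail Q a)))"

text \<open>The linear map by which the path \<open>(x, [a\<^sub>1, \<dots>, a\<^sub>s])\<close> acts, i.e. \<open>V a\<^sub>s * \<dots> * V a\<^sub>1\<close>.\<close>

fun path_mat ::
    "('v, 'a) pre_digraph \<Rightarrow> ('v \<Rightarrow> nat) \<Rightarrow> ('a \<Rightarrow> 'k::field mat) \<Rightarrow> 'v \<times> 'a list \<Rightarrow> 'k mat" where
  "path_mat Q \<beta> V (x, []) = 1\<^sub>m (\<beta> x)"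
| "path_mat Q \<beta> V (x, a # p) = path_mat Q \<beta> V (head Q a, p) * V a"

text \<open>The element \<open>f\<close> of the path algebra acts as zero (entrywise, on each block from \<open>x\<close> to \<open>y\<close>).\<close>

definition satisfies_relation ::
    "('v, 'a) pre_digraph \<Rightarrow> ('v \<Rightarrow> nat) \<Rightarrow> ('a \<Rightarrow> 'k::field mat) \<Rightarrow> ('v, 'a, 'k) path_alg
      \<Rightarrow> bool" where
  "satisfies_relation Q \<beta> V f \<longleftrightarrow>
    (\<forall>x\<in>verts Q. \<forall>y\<in>verts Q. \<forall>i<\<beta> y. \<forall>j<\<beta> x.
      (\<Sum>p\<in>{p \<in> Poly_Mapping.keys f. fst p = x \<and> path_end Q p = y}.
        Poly_Mapping.lookup f p * path_mat Q \<beta> V p $$ (i, j)) = 0)"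

definition Rep ::
    "('v, 'a) pre_digraph \<Rightarrow> ('a \<Rightarrow> 's) \<Rightarrow> ('v \<Rightarrow> nat) \<Rightarrow> ('a \<Rightarrow> nat)
      \<Rightarrow> ('a \<Rightarrow> 'k::field mat) set" where
  "Rep Q c \<beta> r = {V \<in> rep_tuples Q \<beta>.
    (\<forall>f\<in>color_ideal Q c. satisfies_relation Q \<beta> V f) \<and>
    (\<forall>a\<in>arcs Q. vec_space.rank (\<beta> (head Q a)) (V a) \<le> r a)}"

definition GL :: "('v, 'a) pre_digraph \<Rightarrow> ('v \<Rightarrow> nat) \<Rightarrow> ('v \<Rightarrow> 'k::field mat) set" where
  "GL Q \<beta> = (\<Pi>\<^sub>E x\<in>verts Q. {g \<in> carrier_mat (\<beta> x) (\<beta> x). invertible_mat g})"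

definition GL_act ::
    "('v, 'a) pre_digraph \<Rightarrow> ('v \<Rightarrow> 'k::field mat) \<Rightarrow> ('a \<Rightarrow> 'k mat) \<Rightarrow> 'a \<Rightarrow> 'k mat" where
  "GL_act Q g V =
    (\<lambda>a\<in>arcs Q. g (head Q a) * V a * the (mat_inverse (g (tail Q a))))"

definition GL_orbit ::
    "('v, 'a) pre_digraph \<Rightarrow> ('v \<Rightarrow> nat) \<Rightarrow> ('a \<Rightarrow> 'k::field mat) \<Rightarrow> ('a \<Rightarrow> 'k mat) set" where
  "GL_orbit Q \<beta> V = (\<lambda>g. GL_act Q g V) ` GL Q \<beta>"

inductive rep_polynomial ::
    "('v, 'a) pre_digraph \<Rightarrow> ('v \<Rightarrow> nat) \<Rightarrow> (('a \<Rightarrow> 'k::field mat) \<Rightarrow> 'k) \<Rightarrow> bool"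
  for Q \<beta> where
  const: "rep_polynomial Q \<beta> (\<lambda>V. k)"
| coord: "a \<in> arcs Q \<Longrightarrow> i < \<beta> (head Q a) \<Longrightarrow> j < \<beta> (tail Q a) \<Longrightarrow>
    rep_polynomial Q \<beta> (\<lambda>V. V a $$ (i, j))"
| add: "rep_polynomial Q \<beta> f \<Longrightarrow> rep_polynomial Q \<beta> g \<Longrightarrow> rep_polynomial Q \<beta> (\<lambda>V. f V + g V)"
| mult: "rep_polynomial Q \<beta> f \<Longrightarrow> rep_polynomial Q \<beta> g \<Longrightarrow> rep_polynomial Q \<beta> (\<lambda>V. f V * g V)"

definition zariski_closed_in ::
    "('v, 'a) pre_digraph \<Rightarrow> ('v \<Rightarrow> nat) \<Rightarrow> ('a \<Rightarrow> 'k::field mat) set \<Rightarrow> ('a \<Rightarrow> 'k mat) set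
      \<Rightarrow> bool" where
  "zariski_closed_in Q \<beta> X Z \<longleftrightarrow>
    (\<exists>P. (\<forall>f\<in>P. rep_polynomial Q \<beta> f) \<and> Z = {V \<in> X. \<forall>f\<in>P. f V = 0})"

definition zariski_open_in ::
    "('v, 'a) pre_digraph \<Rightarrow> ('v \<Rightarrow> nat) \<Rightarrow> ('a \<Rightarrow> 'k::field mat) set \<Rightarrow> ('a \<Rightarrow> 'k mat) set
      \<Rightarrow> bool" where
  "zariski_open_in Q \<beta> X U \<longleftrightarrow> U \<subseteq> X \<and> zariski_closed_in Q \<beta> X (X - U)"


section \<open>Up-and-down graphs and modules\<close>

definition color_incidences :: "('v, 'a) pre_digraph \<Rightarrow> 's set \<Rightarrow> ('a \<Rightarrow> 's) \<Rightarrow> ('v \<times> 's) set" where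
  "color_incidences Q S c =
    {(x, s). x \<in> verts Q \<and> s \<in> S \<and> (\<exists>a\<in>arcs Q. c a = s \<and> (tail Q a = x \<or> head Q a = x))}"

definition sign_function ::
    "('v, 'a) pre_digraph \<Rightarrow> 's set \<Rightarrow> ('a \<Rightarrow> 's) \<Rightarrow> ('v \<times> 's \<Rightarrow> int) \<Rightarrow> bool" where
  "sign_function Q S c \<epsilon> \<longleftrightarrow>
    \<epsilon> \<in> color_incidences Q S c \<rightarrow> {1, -1} \<and>
    (\<forall>x s1 s2. (x, s1) \<in> color_incidences Q S c \<and> (x, s2) \<in> color_incidences Q S c \<and> s1 \<noteq> s2 \<longrightarrow>
      \<epsilon> (x, s1) = - \<epsilon> (x, s2))"

text \<open>
  The up-and-down graph is an undirected multigraph with vertices \<open>(x, i)\<close> for \<open>v\<^sub>i\<^sup>x\<close>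
  (\<open>1 \<le> i \<le> \<beta> x\<close>) and edges \<open>(a, i)\<close> for the \<open>i\<close>-th edge labeled \<open>a\<close> (\<open>1 \<le> i \<le> r a\<close>). Each edge
  is stored with the orientation of its arrow, i.e. as going from its \<open>v\<^sup>t\<^sup>a\<close>-end to its \<open>v\<^sup>h\<^sup>a\<close>-end;
  if \<open>a\<close> is a loop, only this orientation tells the two ends apart.
\<close>

definition ud_graph ::
    "('v, 'a) pre_digraph \<Rightarrow> ('a \<Rightarrow> 's) \<Rightarrow> ('v \<Rightarrow> nat) \<Rightarrow> ('a \<Rightarrow> nat) \<Rightarrow> ('v \<times> 's \<Rightarrow> int)
      \<Rightarrow> ('v \<times> nat, 'a \<times> nat) pre_digraph" where
  "ud_graph Q c \<beta> r \<epsilon> = \<lparr>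
    verts = {(x, i). x \<in> verts Q \<and> 1 \<le> i \<and> i \<le> \<beta> x},
    arcs = {(a, i). a \<in> arcs Q \<and> 1 \<le> i \<and> i \<le> r a},
    tail = (\<lambda>(a, i). (tail Q a, if \<epsilon> (tail Q a, c a) = 1 then i else \<beta> (tail Q a) - i + 1)),
    head = (\<lambda>(a, i). (head Q a, if \<epsilon> (head Q a, c a) = 1 then \<beta> (head Q a) - i + 1 else i))\<rparr>"

text \<open>
  A band is a component that is a cycle in the sense of multigraphs: a loop is a cycle with one
  vertex, a double edge is a cycle with two vertices.
\<close>

definition undirected_components ::
    "('w, 'e) pre_digraph \<Rightarrow> ('w, 'e) pre_digraph set" where
  "undirected_components G =
    {G \<restriction> {w. v \<rightarrow>\<^sup>*\<^bsub>with_proj (mk_symmetric G)\<^esub> w} | v. v \<in> verts G}"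

definition is_undirected_cycle :: "('w, 'e) pre_digraph \<Rightarrow> bool" where
  "is_undirected_cycle H \<longleftrightarrow>
    (\<exists>vs es. vs \<noteq> [] \<and> length es = length vs \<and> distinct vs \<and> distinct es \<and>
      verts H = set vs \<and> arcs H = set es \<and>
      (\<forall>i<length vs. {tail H (es ! i), head H (es ! i)} = {vs ! i, vs ! (Suc i mod length vs)}))"

definition no_bands :: "('w, 'e) pre_digraph \<Rightarrow> bool" where
  "no_bands G \<longleftrightarrow> (\<forall>H\<in>undirected_components G. \<not> is_undirected_cycle H)"

text \<open>Matrix indices start at 0, so row \<open>k\<close> and column \<open>j\<close> belong to \<open>e\<^sub>k\<^sub>+\<^sub>1\<close> and \<open>e\<^sub>j\<^sub>+\<^sub>1\<close>.\<close>

definition ud_module ::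
    "('v, 'a) pre_digraph \<Rightarrow> ('a \<Rightarrow> 's) \<Rightarrow> ('v \<Rightarrow> nat) \<Rightarrow> ('a \<Rightarrow> nat) \<Rightarrow> ('v \<times> 's \<Rightarrow> int)
      \<Rightarrow> 'a \<Rightarrow> 'k::field mat" where
  "ud_module Q c \<beta> r \<epsilon> = (\<lambda>a\<in>arcs Q.
    mat (\<beta> (head Q a)) (\<beta> (tail Q a)) (\<lambda>(k, j).
      if \<exists>i. (a, i) \<in> arcs (ud_graph Q c \<beta> r \<epsilon>) \<and>
             tail (ud_graph Q c \<beta> r \<epsilon>) (a, i) = (tail Q a, j + 1) \<and>
             head (ud_graph Q c \<beta> r \<epsilon>) (a, i) = (head Q a, k + 1)
      then 1 else 0))"

end

theory Submission
  imports Defs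
begin

text \<open>
  Let \<open>M\<close> be the up-and-down module. The orbit of \<open>M\<close> is open as soon as it contains a neighbourhood of \<open>M\<close>,
  and for this it suffices to extend the identity of \<open>M\<close> to homomorphisms \<open>f : M \<rightarrow> N\<close> depending
  polynomially on \<open>N \<in> Rep(\<beta>, r)\<close>: near \<open>M\<close> they stay invertible. The condition \<open>N f = f M\<close> is a linear
  system in \<open>f\<close>. Where \<open>N\<close> has ranks exactly \<open>r\<close>, the relations of \<open>N\<close> and \<open>M\<close> make part of this system
  redundant. The remaining equations are independent at \<open>M\<close>, so Cramer's rule solves them near \<open>M\<close>.

  At \<open>M\<close> each equation involves at most two unknowns and each unknown, indexed by a pair \<open>(u, v)\<close>
  of vertices of \<open>\<Gamma>\<close> over the same point, lies in at most one equation per color. The equations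
  therefore form walks of pairs, whose components walk along \<open>\<Gamma>\<close>. As there are no bands, these walks end.
  The sign of \<open>v - u\<close> together with \<open>\<epsilon>\<close> shows that a walk cannot end in an equation with a single
  unknown on both sides, whence the independence.
\<close>

section \<open>Minors and rank\<close>

text \<open>Each inner index \<open>k\<close> contributes a matrix of rank at most 1, and rank is
  subadditive.\<close>

lemma (in vec_space) rank_le_if_factorization:
  assumes "A \<in> carrier_mat n m"
    and "\<And>i j. i < n \<Longrightarrow> j < m \<Longrightarrow> A $$ (i, j) = (\<Sum>k<r. b i k * c k j)"
  shows "rank A \<le> r"
  using assms
proof (induction r arbitrary: A)
  case 0
  then have "A = 0\<^sub>m n m" by (intro eq_matI) auto
  then show ?case using rank_0I by simp
next
  case (Suc r)
  let ?B = "mat n m (\<lambda>(i, j). \<Sum>k<r. b i k * c k j)"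
  let ?C = "mat n m (\<lambda>(i, j). b i r * c r j)"
  have "A = ?B + ?C"
    using Suc.prems by (intro eq_matI) auto
  moreover have "rank ?B \<le> r" by (rule Suc.IH) auto
  moreover have "rank ?C \<le> 1"
    by (rule rank_le_1_product_entries[where f = "\<lambda>i. b i r" and g = "c r"]) auto
  moreover have "rank (?B + ?C) \<le> rank ?B + rank ?C"
    by (rule rank_subadditive) auto
  ultimately show ?case by simp
qed

text \<open>The columns of \<open>A\<close> are combinations of a maximal independent set of
  columns, which has \<open>rank A\<close> elements. Together with the converse this turns a rank
  bound into a bound on the inner dimension of a product.\<close>

lemma (in vec_space) factorization_if_rank_le:
  assumes A: "A \<in> carrier_mat n m" and r: "rank A \<le> r"
  obtains b c where "\<And>i j. i < n \<Longrightarrow> j < m \<Longrightarrow> A $$ (i, j) = (\<Sum>k<r. b i k * c k j)"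
proof -
  let ?P = "\<lambda>T. T \<subseteq> set (cols A) \<and> lin_indpt T"
  have carr: "set (cols A) \<subseteq> carrier_vec n" using cols_dim A by blast
  have "?P {}"
    by (metis empty_subsetI fin_dim finite_basis_exists subset_li_is_li vec_vs vectorspace.basis_def)
  then obtain U where U: "finite U" "maximal U ?P"
    using maximal_exists_superset[of "set (cols A)" ?P "{}"] by blast
  have rank: "rank A = card U" by (rule rank_card_indpt[OF A U(2)])
  have PU: "U \<subseteq> set (cols A)" "lin_indpt U" using U(2) by (auto simp: maximal_def)
  have Uc: "U \<subseteq> carrier_vec n" using PU carr by blast
  have span: "v \<in> span U" if "v \<in> set (cols A)" for v
  proof (rule ccontr)
    assume v: "v \<notin> span U"
    have "v \<in> carrier_vec n" using that carr by blast
    have "v \<notin> U" using v span_mem[OF Uc, of v] by auto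
    then have "lin_indpt (U \<union> {v})"
      using lin_dep_iff_in_span[OF Uc PU(2) \<open>v \<in> carrier_vec n\<close> \<open>v \<notin> U\<close>] v by simp
    moreover have "U \<union> {v} \<subseteq> set (cols A)" using PU(1) that by blast
    ultimately have "U \<union> {v} = U"
      using U(2)[unfolded maximal_def, THEN conjunct2, rule_format, of "U \<union> {v}"] by auto
    then show False using \<open>v \<notin> U\<close> by blast
  qed
  have "\<exists>a. v = lincomb a U" if "v \<in> set (cols A)" for v
    using finite_in_span[OF U(1) Uc span[OF that]] by metis
  then have "\<forall>j. \<exists>a. j < m \<longrightarrow> col A j = lincomb a U"
    using A by (metis carrier_matD(2) cols_length cols_nth nth_mem)
  then obtain a where a: "\<And>j. j < m \<Longrightarrow> col A j = lincomb (a j) U"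
    by metis
  obtain u where u: "bij_betw u {..<card U} U"
    using ex_bij_betw_nat_finite[OF U(1)] by (auto simp: atLeast0LessThan)
  \<comment> \<open>If \<open>rank A < r\<close>, the missing columns of the left factor are filled
    with zeros.\<close>
  define b where "b i k = (if k < card U then u k $ i else 0)" for i k
  have "A $$ (i, j) = (\<Sum>k<r. b i k * a j (u k))" if "i < n" "j < m" for i j
  proof -
    have "A $$ (i, j) = col A j $ i" using that A by simp
    also have "\<dots> = (\<Sum>x\<in>U. a j x * x $ i)"
      using a[OF that(2)] lincomb_index[OF that(1) Uc] by simp
    also have "\<dots> = (\<Sum>k<card U. a j (u k) * u k $ i)"
      using sum.reindex_bij_betw[OF u, of "\<lambda>x. a j x * x $ i"] by simp
    also have "\<dots> = (\<Sum>k<card U. b i k * a j (u k))" by (simp add: b_def mult.commute)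
    also have "\<dots> = (\<Sum>k<r. b i k * a j (u k))"
      using r rank by (intro sum.mono_neutral_left) (auto simp: b_def)
    finally show ?thesis .
  qed
  then show thesis using that[of b "\<lambda>k j. a j (u k)"] by blast
qed

text \<open>A nonzero minor of maximal size cuts out coordinates on the column space.\<close>

lemma column_eq_0_if_minor_nonzero:
  fixes N :: "'k::field mat"
  assumes N: "N \<in> carrier_mat n m" "vec_space.rank n N \<le> r"
    and I: "\<And>k. k < r \<Longrightarrow> I k < n" and J: "\<And>k. k < r \<Longrightarrow> J k < m"
    and det: "det (mat r r (\<lambda>(k, l). N $$ (I k, J l))) \<noteq> 0"
    and z: "\<And>k. k < r \<Longrightarrow> (\<Sum>j<m. N $$ (I k, j) * z j) = 0"
    and i: "i < n"
  shows "(\<Sum>j<m. N $$ (i, j) * z j) = 0"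
proof -
  obtain b c where bc: "\<And>i j. i < n \<Longrightarrow> j < m \<Longrightarrow> N $$ (i, j) = (\<Sum>k<r. b i k * c k j)"
    using vec_space.factorization_if_rank_le[OF N] by blast
  \<comment> \<open>The minor is the product of the determinants of two blocks, so the selected rows
    of the left factor form an invertible matrix. It kills \<open>x\<close>, the right factor
    applied to \<open>z\<close>.\<close>
  let ?B = "mat r r (\<lambda>(k, l). b (I k) l)" and ?C = "mat r r (\<lambda>(k, l). c k (J l))"
  have "mat r r (\<lambda>(k, l). N $$ (I k, J l)) = ?B * ?C"
    by (intro eq_matI) (auto simp: bc[OF I J] scalar_prod_def atLeast0LessThan)
  then have "det ?B \<noteq> 0" using det det_mult[of ?B r ?C] by auto
  define x where "x = vec r (\<lambda>k. \<Sum>j<m. c k j * z j)"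
  have "x \<in> carrier_vec r" by (simp add: x_def)
  have Nx: "(\<Sum>j<m. N $$ (i, j) * z j) = (\<Sum>k<r. b i k * x $ k)" if "i < n" for i
  proof -
    have "(\<Sum>j<m. N $$ (i, j) * z j) = (\<Sum>j<m. \<Sum>k<r. b i k * (c k j * z j))"
      using that by (simp add: bc sum_distrib_right mult.assoc)
    also have "\<dots> = (\<Sum>k<r. b i k * x $ k)"
      by (subst sum.swap) (simp add: x_def sum_distrib_left)
    finally show ?thesis .
  qed
  have "?B *\<^sub>v x = 0\<^sub>v r"
    using z Nx[OF I] by (intro eq_vecI) (auto simp: scalar_prod_def atLeast0LessThan x_def)
  then have "x = 0\<^sub>v r"
    using det_0_iff_vec_prod_zero_field[of ?B r] \<open>det ?B \<noteq> 0\<close> \<open>x \<in> carrier_vec r\<close>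
    by (meson mat_carrier)
  then show ?thesis using Nx[OF i] by simp
qed

text \<open>The vector lives on the \<open>r\<close> selected columns, where the selected rows form
  an invertible block. Injectivity of \<open>J\<close> allows the sum over columns to be
  reindexed.\<close>

lemma eq_0_if_minor_nonzero:
  fixes N :: "'k::field mat"
  assumes J: "\<And>k. k < r \<Longrightarrow> J k < m" "inj_on J {..<r}"
    and det: "det (mat r r (\<lambda>(k, l). N $$ (I k, J l))) \<noteq> 0"
    and supp: "\<And>j. j < m \<Longrightarrow> j \<notin> J ` {..<r} \<Longrightarrow> z j = 0"
    and z: "\<And>k. k < r \<Longrightarrow> (\<Sum>j<m. N $$ (I k, j) * z j) = 0"
    and j: "j < m"
  shows "z j = 0"
proof -
  let ?A = "mat r r (\<lambda>(k, l). N $$ (I k, J l))"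
  define x where "x = vec r (\<lambda>k. z (J k))"
  have "x \<in> carrier_vec r" by (simp add: x_def)
  have "(\<Sum>l<r. N $$ (I k, J l) * z (J l)) = 0" if "k < r" for k
  proof -
    have "(\<Sum>l<r. N $$ (I k, J l) * z (J l)) = (\<Sum>j\<in>J ` {..<r}. N $$ (I k, j) * z j)"
      using J(2) by (simp add: sum.reindex)
    also have "\<dots> = (\<Sum>j<m. N $$ (I k, j) * z j)"
      using J(1) supp by (intro sum.mono_neutral_left) auto
    finally show ?thesis using z[OF that] by simp
  qed
  then have "?A *\<^sub>v x = 0\<^sub>v r"
    by (intro eq_vecI) (auto simp: scalar_prod_def atLeast0LessThan x_def)
  then have "x = 0\<^sub>v r"
    using det_0_iff_vec_prod_zero_field[of ?A r] det \<open>x \<in> carrier_vec r\<close>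
    by (meson mat_carrier)
  then have "z (J k) = 0" if "k < r" for k
    using that unfolding x_def by (metis index_vec index_zero_vec(1))
  then show ?thesis using supp j by auto
qed

section \<open>Invertible matrices\<close>

lemma mat_inverse_if_invertible_mat:
  assumes "g \<in> carrier_mat n n" and "invertible_mat (g :: 'k::field mat)"
  shows "the (mat_inverse g) \<in> carrier_mat n n" "g * the (mat_inverse g) = 1\<^sub>m n"
    "the (mat_inverse g) * g = 1\<^sub>m n"
proof -
  obtain B where B: "g * B = 1\<^sub>m n" "B * g = 1\<^sub>m (dim_row B)"
    using assms by (auto simp: invertible_mat_def inverts_mat_def)
  have "B \<in> carrier_mat n n"
    using B assms by (metis carrier_matD(2) carrier_matI index_mult_mat(2,3) index_one_mat(2,3))
  then have "g \<in> Units (ring_mat TYPE('k) n undefined)"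
    using B assms by (auto simp: Units_def ring_mat_simps)
  then have "mat_inverse g \<noteq> None" using mat_inverse(1)[OF assms(1), of undefined] by blast
  then show "the (mat_inverse g) \<in> carrier_mat n n" "g * the (mat_inverse g) = 1\<^sub>m n"
    "the (mat_inverse g) * g = 1\<^sub>m n"
    using mat_inverse(2)[OF assms(1)] by auto
qed

lemma invertible_mat_if_det_nonzero:
  assumes A: "A \<in> carrier_mat n n" and "det (A :: 'k::field mat) \<noteq> 0"
  shows "invertible_mat A"
proof -
  obtain B where "B \<in> carrier_mat n n" "A * B = 1\<^sub>m n" "B * A = 1\<^sub>m n"
    using det_non_zero_imp_unit[OF A assms(2), of undefined]
    by (auto simp: Units_def ring_mat_simps)
  then show ?thesis using A by (auto simp: invertible_mat_def inverts_mat_def)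
qed

section \<open>Polynomials on the representation space\<close>

lemma rep_polynomial_sum:
  assumes "\<And>i. i \<in> A \<Longrightarrow> rep_polynomial Q \<beta> (f i)"
  shows "rep_polynomial Q \<beta> (\<lambda>V. \<Sum>i\<in>A. f i V)"
  using assms
  by (induction A rule: infinite_finite_induct) (auto intro: rep_polynomial.intros)

lemma rep_polynomial_prod:
  assumes "\<And>i. i \<in> A \<Longrightarrow> rep_polynomial Q \<beta> (f i)"
  shows "rep_polynomial Q \<beta> (\<lambda>V. \<Prod>i\<in>A. f i V)"
  using assms
  by (induction A rule: infinite_finite_induct) (auto intro: rep_polynomial.intros)

lemma rep_polynomial_diff:
  assumes "rep_polynomial Q \<beta> f" "rep_polynomial Q \<beta> g"
  shows "rep_polynomial Q \<beta> (\<lambda>V. f V - g V)"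
proof -
  have "rep_polynomial Q \<beta> (\<lambda>V. f V + (- 1) * g V)"
    using assms by (intro rep_polynomial.intros)
  then show ?thesis by simp
qed

lemma rep_polynomial_det:
  assumes "\<And>V. X V \<in> carrier_mat n n"
    and "\<And>i j. i < n \<Longrightarrow> j < n \<Longrightarrow> rep_polynomial Q \<beta> (\<lambda>V. X V $$ (i, j))"
  shows "rep_polynomial Q \<beta> (\<lambda>V. det (X V))"
  unfolding det_def'[OF assms(1)]
  by (intro rep_polynomial_sum rep_polynomial.mult rep_polynomial_prod rep_polynomial.const assms(2))
    (auto dest: permutes_in_image)

lemma rep_polynomial_adj_mat:
  assumes X: "\<And>V. X V \<in> carrier_mat n n"
    and poly: "\<And>i j. i < n \<Longrightarrow> j < n \<Longrightarrow> rep_polynomial Q \<beta> (\<lambda>V. X V $$ (i, j))"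
    and "i < n" "j < n"
  shows "rep_polynomial Q \<beta> (\<lambda>V. adj_mat (X V) $$ (i, j))"
proof -
  have dim: "dim_row (X V) = n" "dim_col (X V) = n" for V
    using X[of V] by auto
  have "rep_polynomial Q \<beta> (\<lambda>V. det (mat_delete (X V) j i))"
  proof (rule rep_polynomial_det)
    show "mat_delete (X V) j i \<in> carrier_mat (n - 1) (n - 1)" for V
      by (rule mat_delete_carrier[OF X])
    show "rep_polynomial Q \<beta> (\<lambda>V. mat_delete (X V) j i $$ (k, l))" if "k < n - 1" "l < n - 1" for k l
      using that by (simp add: mat_delete_def dim) (intro conjI impI poly; linarith)
  qed
  then show ?thesis
    using assms(3,4) by (simp add: adj_mat_def cofactor_def dim rep_polynomial.intros)
qed

text \<open>Each coordinate of the translate is linear in the coordinates of \<open>V\<close>, with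
  coefficients from \<open>g\<close> and its inverse. This carries a neighbourhood of one point of
  an orbit to the others.\<close>

lemma rep_polynomial_GL_act:
  assumes "rep_polynomial Q \<beta> h" and "fin_digraph Q" and g: "g \<in> GL Q \<beta>"
  shows "\<exists>h'. rep_polynomial Q \<beta> h' \<and> (\<forall>V\<in>rep_tuples Q \<beta>. h' V = h (GL_act Q g V))"
  using assms(1)
proof induction
  case (const k)
  then show ?case using rep_polynomial.const by blast
next
  case (coord a i j)
  interpret fin_digraph Q by fact
  let ?h = "\<beta> (head Q a)" and ?t = "\<beta> (tail Q a)"
  let ?k = "the (mat_inverse (g (tail Q a)))"
  have gh: "g (head Q a) \<in> carrier_mat ?h ?h"
    using g coord(1) by (auto simp: GL_def)
  have gt: "?k \<in> carrier_mat ?t ?t"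
    using g coord(1) by (intro mat_inverse_if_invertible_mat) (auto simp: GL_def)
  let ?f = "\<lambda>V. \<Sum>k<?h. g (head Q a) $$ (i, k) * (\<Sum>l<?t. V a $$ (k, l) * ?k $$ (l, j))"
  have "rep_polynomial Q \<beta> ?f"
    using coord by (intro rep_polynomial_sum rep_polynomial.intros) auto
  moreover have "?f V = GL_act Q g V a $$ (i, j)" if "V \<in> rep_tuples Q \<beta>" for V
  proof -
    have "V a \<in> carrier_mat ?h ?t" using that coord(1) by (auto simp: rep_tuples_def)
    then show ?thesis
      using coord gh gt by (simp add: GL_act_def scalar_prod_def atLeast0LessThan)
  qed
  ultimately show ?case by blast
next
  case (add f1 f2)
  then obtain h1 h2 where "rep_polynomial Q \<beta> h1" "rep_polynomial Q \<beta> h2"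
    "\<forall>V\<in>rep_tuples Q \<beta>. h1 V = f1 (GL_act Q g V) \<and> h2 V = f2 (GL_act Q g V)" by blast
  then show ?case
    by (intro exI[of _ "\<lambda>V. h1 V + h2 V"]) (auto intro: rep_polynomial.intros)
next
  case (mult f1 f2)
  then obtain h1 h2 where "rep_polynomial Q \<beta> h1" "rep_polynomial Q \<beta> h2"
    "\<forall>V\<in>rep_tuples Q \<beta>. h1 V = f1 (GL_act Q g V) \<and> h2 V = f2 (GL_act Q g V)" by blast
  then show ?case
    by (intro exI[of _ "\<lambda>V. h1 V * h2 V"]) (auto intro: rep_polynomial.intros)
qed

section \<open>The relations of the color ideal\<close>

lemma keys_path_alg_mult:
  assumes "p \<in> Poly_Mapping.keys (path_alg_mult Q f g)"
  obtains p1 p2 where "p1 \<in> Poly_Mapping.keys f" "p2 \<in> Poly_Mapping.keys g"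
    "path_end Q p2 = fst p1" "p = (fst p2, snd p2 @ snd p1)"
proof -
  let ?F = "\<lambda>p q. if path_end Q q = fst p
      then Poly_Mapping.single (fst q, snd q @ snd p)
             (Poly_Mapping.lookup f p * Poly_Mapping.lookup g q)
      else 0"
  have "Poly_Mapping.lookup (path_alg_mult Q f g) p \<noteq> 0"
    using assms by (simp add: Poly_Mapping.in_keys_iff)
  then obtain p1 where p1: "p1 \<in> Poly_Mapping.keys f"
      "(\<Sum>q\<in>Poly_Mapping.keys g. Poly_Mapping.lookup (?F p1 q) p) \<noteq> 0"
    unfolding path_alg_mult_def Poly_Mapping.lookup_sum by (meson sum.neutral)
  then obtain p2 where "p2 \<in> Poly_Mapping.keys g" "Poly_Mapping.lookup (?F p1 p2) p \<noteq> 0"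
    by (meson sum.neutral)
  then show thesis
    using that[OF p1(1)] by (auto simp: Poly_Mapping.lookup_single when_def split: if_splits)
qed

text \<open>Candidates for the paths lying in the color ideal; \<open>keys_color_ideal\<close> shows
  that no other path occurs in an element of it.\<close>

definition repeating_paths :: "('v, 'a) pre_digraph \<Rightarrow> ('a \<Rightarrow> 's) \<Rightarrow> ('v \<times> 'a list) set" where
  "repeating_paths Q c = {(x, p) \<in> paths Q. \<exists>p1 a b p2. p = p1 @ [a, b] @ p2 \<and> c a = c b}"

lemma repeating_paths_subset: "repeating_paths Q c \<subseteq> paths Q"
  by (auto simp: repeating_paths_def)

lemma rep_tuplesD:
  assumes "V \<in> rep_tuples Q \<beta>" "a \<in> arcs Q"
  shows "V a \<in> carrier_mat (\<beta> (head Q a)) (\<beta> (tail Q a))"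
  using assms unfolding rep_tuples_def by (rule PiE_mem)

context wf_digraph
begin

lemma paths_append:
  assumes "p1 \<in> paths G" "p2 \<in> paths G" "path_end G p2 = fst p1"
  shows "(fst p2, snd p2 @ snd p1) \<in> paths G"
proof -
  obtain y1 y2 where walks: "awalk (fst p1) (snd p1) y1" "awalk (fst p2) (snd p2) y2"
    using assms(1,2) unfolding paths_def by auto
  then have "y2 = fst p1" using assms(3) by (metis awlast_if_cas awalk_def)
  then have "awalk (fst p2) (snd p2 @ snd p1) y1" using walks awalk_appendI by blast
  then show ?thesis unfolding paths_def by blast
qed

lemma repeating_paths_append:
  assumes "p1 \<in> paths G" "p2 \<in> paths G" "path_end G p2 = fst p1"
    and "p1 \<in> repeating_paths G c \<or> p2 \<in> repeating_paths G c"
  shows "(fst p2, snd p2 @ snd p1) \<in> repeating_paths G c"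
proof -
  have "\<exists>q1 a b q2. snd p2 @ snd p1 = q1 @ [a, b] @ q2 \<and> c a = c b"
    using assms(4)
  proof
    assume "p1 \<in> repeating_paths G c"
    then obtain q1 a b q2 where "snd p1 = q1 @ [a, b] @ q2" "c a = c b"
      by (auto simp: repeating_paths_def)
    then show ?thesis
      by (intro exI[of _ "snd p2 @ q1"] exI[of _ a] exI[of _ b] exI[of _ q2]) simp
  next
    assume "p2 \<in> repeating_paths G c"
    then obtain q1 a b q2 where "snd p2 = q1 @ [a, b] @ q2" "c a = c b"
      by (auto simp: repeating_paths_def)
    then show ?thesis
      by (intro exI[of _ q1] exI[of _ a] exI[of _ b] exI[of _ "q2 @ snd p1"]) simp
  qed
  then show ?thesis using paths_append[OF assms(1-3)] by (simp add: repeating_paths_def)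
qed

text \<open>The ideal \<open>I\<^sub>c\<close> is spanned by the paths it contains.\<close>

lemma keys_color_ideal:
  assumes "f \<in> color_ideal G c"
  shows "Poly_Mapping.keys f \<subseteq> repeating_paths G c"
  using assms unfolding color_ideal_def
proof induction
  case (gen f)
  then obtain a b where ab: "a \<in> arcs G" "b \<in> arcs G" "head G a = tail G b" "c a = c b"
    "f = path2 G a b" by blast
  have "awalk (tail G a) [a, b] (head G b)"
    using ab by (auto simp: awalk_def)
  then have "(tail G a, [a, b]) \<in> repeating_paths G c"
    using ab(4) by (force simp: repeating_paths_def paths_def)
  then show ?case using ab(5) by (auto simp: path2_def)
next
  case (add f g)
  then show ?case using Poly_Mapping.keys_add[of f g] by blast
next
  case (mult_left f h)
  show ?case
  proof
    fix p assume "p \<in> Poly_Mapping.keys (path_alg_mult G h f)"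
    then obtain p1 p2 where p: "p1 \<in> Poly_Mapping.keys h" "p2 \<in> Poly_Mapping.keys f"
      "path_end G p2 = fst p1" "p = (fst p2, snd p2 @ snd p1)" by (rule keys_path_alg_mult)
    moreover have "p1 \<in> paths G" "p2 \<in> paths G"
        "p1 \<in> repeating_paths G c \<or> p2 \<in> repeating_paths G c"
      using p(1,2) mult_left repeating_paths_subset[of G c]
      by (auto simp: path_alg_carrier_def)
    ultimately show "p \<in> repeating_paths G c" using repeating_paths_append by blast
  qed
next
  case (mult_right f h)
  show ?case
  proof
    fix p assume "p \<in> Poly_Mapping.keys (path_alg_mult G f h)"
    then obtain p1 p2 where p: "p1 \<in> Poly_Mapping.keys f" "p2 \<in> Poly_Mapping.keys h"
      "path_end G p2 = fst p1" "p = (fst p2, snd p2 @ snd p1)" by (rule keys_path_alg_mult)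
    moreover have "p1 \<in> paths G" "p2 \<in> paths G"
        "p1 \<in> repeating_paths G c \<or> p2 \<in> repeating_paths G c"
      using p(1,2) mult_right repeating_paths_subset[of G c]
      by (auto simp: path_alg_carrier_def)
    ultimately show "p \<in> repeating_paths G c" using repeating_paths_append by blast
  qed
qed auto

lemma path_mat_carrier:
  assumes "V \<in> rep_tuples G \<beta>" "awalk x p y"
  shows "path_mat G \<beta> V (x, p) \<in> carrier_mat (\<beta> y) (\<beta> x)"
  using assms(2)
proof (induction p arbitrary: x)
  case (Cons a p)
  then have "V a \<in> carrier_mat (\<beta> (head G a)) (\<beta> x)"
      "path_mat G \<beta> V (head G a, p) \<in> carrier_mat (\<beta> y) (\<beta> (head G a))"
    using rep_tuplesD[OF assms(1)] by (auto simp: awalk_Cons_iff)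
  then show ?case by simp
qed (auto simp: awalk_Nil_iff)

text \<open>The vanishing factor \<open>V b * V a\<close> occurs inside the product along the path.
  Removing an initial arrow removes a factor on the right, hence the induction on
  \<open>p1\<close>.\<close>

lemma path_mat_repeating:
  assumes V: "V \<in> rep_tuples G \<beta>"
    and rel: "\<And>a b. a \<in> arcs G \<Longrightarrow> b \<in> arcs G \<Longrightarrow> head G a = tail G b \<Longrightarrow> c a = c b \<Longrightarrow>
      V b * V a = 0\<^sub>m (\<beta> (head G b)) (\<beta> (tail G a))"
    and "awalk x (p1 @ [a, b] @ p2) y" "c a = c b"
  shows "path_mat G \<beta> V (x, p1 @ [a, b] @ p2) = 0\<^sub>m (\<beta> y) (\<beta> x)"
  using assms(3)
proof (induction p1 arbitrary: x)
  case Nil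
  then have ab: "a \<in> arcs G" "b \<in> arcs G" "head G a = tail G b" "x = tail G a"
    and p2: "awalk (head G b) p2 y"
    by (auto simp: awalk_Cons_iff)
  have "V a \<in> carrier_mat (\<beta> (head G a)) (\<beta> x)" "V b \<in> carrier_mat (\<beta> (head G b)) (\<beta> (head G a))"
    using rep_tuplesD[OF V] ab by metis+
  then show ?case
    using path_mat_carrier[OF V p2] rel[OF ab(1-3) assms(4)] ab(4)
    by (simp add: assoc_mult_mat)
next
  case (Cons d p1)
  then have "V d \<in> carrier_mat (\<beta> (head G d)) (\<beta> x)"
    using rep_tuplesD[OF V] by (auto simp: awalk_Cons_iff)
  with Cons show ?case by (auto simp: awalk_Cons_iff)
qed

text \<open>The relations of the whole ideal reduce to its generators: a generator is tested on its
  single path, and conversely every path in the support of an element contains a vanishing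
  product.\<close>

lemma Rep_iff:
  fixes V :: "'b \<Rightarrow> 'd::field mat"
  shows "V \<in> Rep G c \<beta> r \<longleftrightarrow> V \<in> rep_tuples G \<beta> \<and>
    (\<forall>a\<in>arcs G. \<forall>b\<in>arcs G. head G a = tail G b \<and> c a = c b \<longrightarrow>
      V b * V a = 0\<^sub>m (\<beta> (head G b)) (\<beta> (tail G a))) \<and>
    (\<forall>a\<in>arcs G. vec_space.rank (\<beta> (head G a)) (V a) \<le> r a)"
  (is "_ \<longleftrightarrow> ?V \<and> ?rel \<and> _")
proof -
  have "(\<forall>f\<in>color_ideal G c. satisfies_relation G \<beta> V f) \<longleftrightarrow> ?rel" if V: ?V
  proof (intro iffI ballI impI)
    fix a b assume sat: "\<forall>f\<in>color_ideal G c. satisfies_relation G \<beta> V f"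
      and ab: "a \<in> arcs G" "b \<in> arcs G" "head G a = tail G b \<and> c a = c b"
    have carr: "V a \<in> carrier_mat (\<beta> (head G a)) (\<beta> (tail G a))"
        "V b \<in> carrier_mat (\<beta> (head G b)) (\<beta> (head G a))"
      using rep_tuplesD[OF V] ab by metis+
    have "path2 G a b \<in> color_ideal G c"
      unfolding color_ideal_def using ab by (intro path_ideal.gen) auto
    then have "satisfies_relation G \<beta> V (path2 G a b)" using sat by blast
    moreover have keys: "{p \<in> Poly_Mapping.keys (path2 G a b :: ('a, 'b, 'd) path_alg).
        fst p = tail G a \<and> path_end G p = head G b} = {(tail G a, [a, b])}"
      by (auto simp: path2_def)
    ultimately have "(V b * V a) $$ (i, j) = 0" if ij: "i < \<beta> (head G b)" "j < \<beta> (tail G a)" for i j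
    proof -
      have "(\<Sum>p\<in>{p \<in> Poly_Mapping.keys (path2 G a b :: ('a, 'b, 'd) path_alg).
          fst p = tail G a \<and> path_end G p = head G b}.
          Poly_Mapping.lookup (path2 G a b) p * path_mat G \<beta> V p $$ (i, j)) = 0"
        using \<open>satisfies_relation G \<beta> V (path2 G a b)\<close> ab(1,2) ij
        unfolding satisfies_relation_def by (meson head_in_verts tail_in_verts)
      then show ?thesis unfolding keys using carr by (simp add: path2_def)
    qed
    then show "V b * V a = 0\<^sub>m (\<beta> (head G b)) (\<beta> (tail G a))"
      using carr by (intro eq_matI) auto
  next
    fix f :: "('a, 'b, 'd) path_alg" assume rel: ?rel and f: "f \<in> color_ideal G c"
    have "path_mat G \<beta> V p $$ (i, j) = 0"
      if pf: "p \<in> Poly_Mapping.keys f"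
        and ij: "i < \<beta> (path_end G p)" "j < \<beta> (fst p)" for p i j
    proof -
      obtain x p1 a b p2 y where p: "p = (x, p1 @ [a, b] @ p2)" "c a = c b"
        and walk: "awalk x (p1 @ [a, b] @ p2) y"
        using subsetD[OF keys_color_ideal[OF f] pf]
        unfolding repeating_paths_def paths_def by blast
      have "path_mat G \<beta> V p = 0\<^sub>m (\<beta> y) (\<beta> x)"
        unfolding p(1) using rel by (intro path_mat_repeating[OF V _ walk p(2)]) blast
      moreover have "path_end G p = y" "fst p = x"
        using walk unfolding p(1) fst_conv snd_conv by (auto simp only: awlast_of_awalk awalkE)
      ultimately show ?thesis using ij by simp
    qed
    then show "satisfies_relation G \<beta> V f"
      unfolding satisfies_relation_def by (intro ballI allI impI sum.neutral) auto
  qed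
  then show ?thesis unfolding Rep_def by blast
qed

end

section \<open>Openness of orbits\<close>

lemma det_nonzero_if_invertible_mat:
  assumes "g \<in> carrier_mat n n" "invertible_mat (g :: 'k::field mat)"
  shows "det g \<noteq> 0"
  using det_mult[OF assms(1) mat_inverse_if_invertible_mat(1)[OF assms]]
    mat_inverse_if_invertible_mat(2)[OF assms] by auto

lemma mult_mat_assoc4:
  fixes A :: "'k::semiring_0 mat"
  assumes "A \<in> carrier_mat n1 n2" "B \<in> carrier_mat n2 n3" "C \<in> carrier_mat n3 n4" "D \<in> carrier_mat n4 n5"
  shows "A * B * (C * D) = A * (B * C) * D"
  unfolding assoc_mult_mat[OF assms(1-3), symmetric]
  by (rule assoc_mult_mat[OF mult_carrier_mat[OF assms(1,2)] assms(3,4), symmetric])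

section \<open>The action by base change\<close>

context wf_digraph
begin

lemma GL_iff:
  "g \<in> GL G \<beta> \<longleftrightarrow> g \<in> extensional (verts G) \<and>
    (\<forall>x\<in>verts G. g x \<in> carrier_mat (\<beta> x) (\<beta> x) \<and> det (g x) \<noteq> (0 :: 'k::field))"
  unfolding GL_def PiE_def Pi_def
  using det_nonzero_if_invertible_mat invertible_mat_if_det_nonzero by blast

text \<open>Multiplication by \<open>g (tail G a)\<close> clears the inverse, so a base change from
  \<open>V\<close> to \<open>W\<close> is the same as an isomorphism of representations.\<close>

lemma GL_act_eq_iff:
  assumes g: "g \<in> GL G \<beta>" and V: "V \<in> rep_tuples G \<beta>" and W: "W \<in> rep_tuples G \<beta>"
  shows "GL_act G g V = W \<longleftrightarrow>
    (\<forall>a\<in>arcs G. W a * g (tail G a) = g (head G a) * (V a :: 'k::field mat))"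
proof -
  have "g (head G a) * V a * the (mat_inverse (g (tail G a))) = W a \<longleftrightarrow>
      W a * g (tail G a) = g (head G a) * V a" if a: "a \<in> arcs G" for a
  proof -
    let ?h = "g (head G a)" and ?t = "g (tail G a)" and ?i = "the (mat_inverse (g (tail G a)))"
    have h: "?h \<in> carrier_mat (\<beta> (head G a)) (\<beta> (head G a))"
      and t: "?t \<in> carrier_mat (\<beta> (tail G a)) (\<beta> (tail G a))" "invertible_mat ?t"
      using g a by (auto simp: GL_def)
    note i = mat_inverse_if_invertible_mat[OF t]
    note Va = rep_tuplesD[OF V a] and Wa = rep_tuplesD[OF W a]
    have hV: "?h * V a \<in> carrier_mat (\<beta> (head G a)) (\<beta> (tail G a))"
      using h Va by simp
    show ?thesis
    proof
      assume *: "?h * V a * ?i = W a"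
      have "W a * ?t = ?h * V a * (?i * ?t)"
        unfolding *[symmetric] by (rule assoc_mult_mat[OF hV i(1) t(1)])
      then show "W a * ?t = ?h * V a" unfolding i(3) right_mult_one_mat[OF hV] .
    next
      assume *: "W a * ?t = ?h * V a"
      have "?h * V a * ?i = W a * (?t * ?i)"
        unfolding *[symmetric] by (rule assoc_mult_mat[OF Wa t(1) i(1)])
      then show "?h * V a * ?i = W a" unfolding i(2) right_mult_one_mat[OF Wa] .
    qed
  qed
  moreover have "GL_act G g V = W \<longleftrightarrow>
      (\<forall>a\<in>arcs G. g (head G a) * V a * the (mat_inverse (g (tail G a))) = W a)"
  proof
    assume "GL_act G g V = W"
    then show "\<forall>a\<in>arcs G. g (head G a) * V a * the (mat_inverse (g (tail G a))) = W a"
      by (auto simp: GL_act_def)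
  next
    assume "\<forall>a\<in>arcs G. g (head G a) * V a * the (mat_inverse (g (tail G a))) = W a"
    then show "GL_act G g V = W"
      using W unfolding GL_act_def rep_tuples_def
      by (intro extensionalityI[of _ "arcs G"]) (auto simp: PiE_def)
  qed
  ultimately show ?thesis by simp
qed

lemma GL_act_carrier:
  assumes g: "g \<in> GL G \<beta>" and V: "V \<in> rep_tuples G \<beta>"
  shows "GL_act G g V \<in> rep_tuples G \<beta>"
  unfolding rep_tuples_def GL_act_def
proof (rule restrict_PiE_iff[THEN iffD2, rule_format])
  fix a assume a: "a \<in> arcs G"
  then have "g (head G a) \<in> carrier_mat (\<beta> (head G a)) (\<beta> (head G a))"
    "g (tail G a) \<in> carrier_mat (\<beta> (tail G a)) (\<beta> (tail G a))" "invertible_mat (g (tail G a))"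
    using g by (auto simp: GL_def)
  then show "g (head G a) * V a * the (mat_inverse (g (tail G a)))
      \<in> carrier_mat (\<beta> (head G a)) (\<beta> (tail G a))"
    using mat_inverse_if_invertible_mat(1) rep_tuplesD[OF V a] by (meson mult_carrier_mat)
qed

text \<open>In \<open>W b * W a\<close> the base changes at the middle vertex cancel. For the rank,
  a factorization of \<open>V a\<close> through \<open>r a\<close> coordinates is multiplied from
  both sides.\<close>

lemma GL_act_Rep:
  assumes g: "g \<in> GL G \<beta>" and V: "V \<in> Rep G c \<beta> r"
  shows "GL_act G g V \<in> Rep G c \<beta> r"
proof -
  have Vc: "V \<in> rep_tuples G \<beta>" using V Rep_iff by blast
  define W where "W = GL_act G g V"
  have Wc: "W \<in> rep_tuples G \<beta>" unfolding W_def by (rule GL_act_carrier[OF g Vc])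
  have W: "W a * g (tail G a) = g (head G a) * V a" if "a \<in> arcs G" for a
    using GL_act_eq_iff[OF g Vc Wc] that W_def by blast
  have gc: "g x \<in> carrier_mat (\<beta> x) (\<beta> x)" "invertible_mat (g x)" if "x \<in> verts G" for x
    using g that by (auto simp: GL_def)
  let ?i = "\<lambda>x. the (mat_inverse (g x))"
  have ic: "?i x \<in> carrier_mat (\<beta> x) (\<beta> x)" if "x \<in> verts G" for x
    by (rule mat_inverse_if_invertible_mat(1)[OF gc[OF that]])
  have W_eq: "W a = g (head G a) * V a * ?i (tail G a)" if "a \<in> arcs G" for a
    using that by (simp add: W_def GL_act_def)
  have "W b * W a = 0\<^sub>m (\<beta> (head G b)) (\<beta> (tail G a))"
    if ab: "a \<in> arcs G" "b \<in> arcs G" "head G a = tail G b" "c a = c b" for a b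
  proof -
    let ?ha = "\<beta> (head G a)" and ?ta = "\<beta> (tail G a)" and ?hb = "\<beta> (head G b)"
    have c: "V a \<in> carrier_mat ?ha ?ta" "V b \<in> carrier_mat ?hb ?ha" "W b \<in> carrier_mat ?hb ?ha"
      using rep_tuplesD Vc Wc ab by metis+
    have g1: "g (head G a) \<in> carrier_mat ?ha ?ha" "g (head G b) \<in> carrier_mat ?hb ?hb"
      using gc ab by auto
    have i: "?i (tail G a) \<in> carrier_mat ?ta ?ta"
      using ic ab by auto
    have gV: "g (head G a) * V a \<in> carrier_mat ?ha ?ta" using g1(1) c(1) by simp
    have "W b * W a = W b * (g (head G a) * V a) * ?i (tail G a)"
      unfolding W_eq[OF ab(1)] by (rule assoc_mult_mat[OF c(3) gV i, symmetric])
    also have "W b * (g (head G a) * V a) = W b * g (tail G b) * V a"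
      unfolding ab(3)[symmetric] by (rule assoc_mult_mat[OF c(3) g1(1) c(1), symmetric])
    also have "\<dots> = g (head G b) * (V b * V a)"
      unfolding W[OF ab(2)] by (rule assoc_mult_mat[OF g1(2) c(2,1)])
    also have "V b * V a = 0\<^sub>m ?hb ?ta" using V ab Rep_iff by blast
    finally show ?thesis using g1 i by simp
  qed
  moreover have "vec_space.rank (\<beta> (head G a)) (W a) \<le> r a" if a: "a \<in> arcs G" for a
  proof -
    let ?h = "\<beta> (head G a)" and ?t = "\<beta> (tail G a)"
    note Va = rep_tuplesD[OF Vc a]
    have gh: "g (head G a) \<in> carrier_mat ?h ?h" using gc a by auto
    have i: "?i (tail G a) \<in> carrier_mat ?t ?t"
      using ic a by auto
    have "vec_space.rank ?h (V a) \<le> r a" using V a Rep_iff by blast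
    then obtain p q where pq: "\<And>i j. i < ?h \<Longrightarrow> j < ?t \<Longrightarrow> V a $$ (i, j) = (\<Sum>k<r a. p i k * q k j)"
      using vec_space.factorization_if_rank_le[OF Va] by blast
    let ?p = "\<lambda>i k. \<Sum>l<?h. g (head G a) $$ (i, l) * p l k"
      and ?q = "\<lambda>k j. \<Sum>m<?t. q k m * ?i (tail G a) $$ (m, j)"
    have "W a $$ (i, j) = (\<Sum>k<r a. ?p i k * ?q k j)" if "i < ?h" "j < ?t" for i j
    proof -
      have gV: "(g (head G a) * V a) $$ (i, m) = (\<Sum>k<r a. ?p i k * q k m)" if "m < ?t" for m
      proof -
        have "(g (head G a) * V a) $$ (i, m) = (\<Sum>l<?h. g (head G a) $$ (i, l) * V a $$ (l, m))"
          using gh Va \<open>i < ?h\<close> that by (simp add: scalar_prod_def atLeast0LessThan)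
        also have "\<dots> = (\<Sum>l<?h. \<Sum>k<r a. g (head G a) $$ (i, l) * p l k * q k m)"
          using that by (simp add: pq sum_distrib_left mult.assoc)
        also have "\<dots> = (\<Sum>k<r a. ?p i k * q k m)"
          by (subst sum.swap) (simp add: sum_distrib_right)
        finally show ?thesis .
      qed
      have "W a $$ (i, j) = (\<Sum>m<?t. (g (head G a) * V a) $$ (i, m) * ?i (tail G a) $$ (m, j))"
        unfolding W_eq[OF a] using gh Va i that
        by (subst index_mult_mat) (auto simp: scalar_prod_def atLeast0LessThan)
      also have "\<dots> = (\<Sum>m<?t. \<Sum>k<r a. ?p i k * (q k m * ?i (tail G a) $$ (m, j)))"
        by (simp add: gV sum_distrib_right mult.assoc)
      also have "\<dots> = (\<Sum>k<r a. ?p i k * ?q k j)"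
        by (subst sum.swap) (simp add: sum_distrib_left)
      finally show ?thesis .
    qed
    then show ?thesis
      by (rule vec_space.rank_le_if_factorization[OF rep_tuplesD[OF Wc a]])
  qed
  ultimately show ?thesis using Wc Rep_iff W_def by blast
qed

end

text \<open>Base change moves the neighbourhood \<open>h \<noteq> 0\<close> of \<open>M\<close> to
  every point of the orbit, so openness has to be seen at \<open>M\<close> only.\<close>

lemma zariski_open_GL_orbit:
  assumes "fin_digraph Q" and M: "M \<in> Rep Q c \<beta> r" and h: "rep_polynomial Q \<beta> h" "h M \<noteq> 0"
    and nbhd: "\<And>V. V \<in> Rep Q c \<beta> r \<Longrightarrow> h V \<noteq> 0 \<Longrightarrow> V \<in> GL_orbit Q \<beta> M"
  shows "zariski_open_in Q \<beta> (Rep Q c \<beta> r) (GL_orbit Q \<beta> M)"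
proof -
  interpret fin_digraph Q by fact
  let ?R = "Rep Q c \<beta> r" and ?O = "GL_orbit Q \<beta> M"
  have R: "V \<in> rep_tuples Q \<beta>" if "V \<in> ?R" for V using that Rep_iff by blast
  have sub: "?O \<subseteq> ?R" using M by (auto simp: GL_orbit_def intro: GL_act_Rep)
  \<comment> \<open>All polynomials vanishing off the orbit. The complement is their zero set as
    soon as at every point of the orbit one of them is nonzero.\<close>
  define P where "P = {f. rep_polynomial Q \<beta> f \<and> (\<forall>V\<in>?R - ?O. f V = 0)}"
  have "\<exists>f\<in>P. f W \<noteq> 0" if WO: "W \<in> ?O" for W
  proof -
    obtain g where g: "g \<in> GL Q \<beta>" "W = GL_act Q g M" using WO by (auto simp: GL_orbit_def)
    have gc: "g x \<in> carrier_mat (\<beta> x) (\<beta> x)" "invertible_mat (g x)" if "x \<in> verts Q" for x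
      using g(1) that by (auto simp: GL_def)
    \<comment> \<open>\<open>k\<close> is the inverse of \<open>g\<close> in the group, and
      \<open>h'\<close> below is \<open>h\<close> after translation by \<open>k\<close>, hence
      nonzero at \<open>W\<close>.\<close>
    define k where "k = (\<lambda>x\<in>verts Q. the (mat_inverse (g x)))"
    have k: "k x \<in> carrier_mat (\<beta> x) (\<beta> x)" "g x * k x = 1\<^sub>m (\<beta> x)" "k x * g x = 1\<^sub>m (\<beta> x)"
      if "x \<in> verts Q" for x
      using mat_inverse_if_invertible_mat[OF gc[OF that]] that by (auto simp: k_def)
    have "det (k x) \<noteq> 0" if "x \<in> verts Q" for x
      using det_mult[OF k(1) gc(1), OF that that] k(3)[OF that] by auto
    then have kGL: "k \<in> GL Q \<beta>" using k(1) by (auto simp: GL_iff k_def)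
    obtain h' where h': "rep_polynomial Q \<beta> h'" "\<forall>V\<in>rep_tuples Q \<beta>. h' V = h (GL_act Q k V)"
      using rep_polynomial_GL_act[OF h(1) assms(1) kGL] by blast
    have W: "W \<in> rep_tuples Q \<beta>" using WO sub R by blast
    have W_eq: "W a * g (tail Q a) = g (head Q a) * M a" if "a \<in> arcs Q" for a
      using GL_act_eq_iff[OF g(1) R[OF M] W] g(2) that by blast
    have inverse: "M' a * k (tail Q a) = k (head Q a) * W' a \<longleftrightarrow> W' a * g (tail Q a) = g (head Q a) * M' a"
      if a: "a \<in> arcs Q" and c: "M' \<in> rep_tuples Q \<beta>" "W' \<in> rep_tuples Q \<beta>" for M' W' a
    proof -
      let ?h = "head Q a" and ?t = "tail Q a"
      have v: "?h \<in> verts Q" "?t \<in> verts Q" using a by auto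
      note ca = rep_tuplesD[OF c(1) a] rep_tuplesD[OF c(2) a]
      note kh = k[OF v(1)] and kt = k[OF v(2)] and gh = gc(1)[OF v(1)] and gt = gc(1)[OF v(2)]
      show ?thesis
      proof
        assume *: "M' a * k ?t = k ?h * W' a"
        have "g ?h * M' a = g ?h * M' a * (k ?t * g ?t)"
          unfolding kt(3) by (rule right_mult_one_mat[OF mult_carrier_mat[OF gh ca(1)], symmetric])
        also have "\<dots> = g ?h * (M' a * k ?t) * g ?t"
          by (rule mult_mat_assoc4[OF gh ca(1) kt(1) gt])
        also have "\<dots> = g ?h * (k ?h * W' a) * g ?t" unfolding * ..
        also have "g ?h * (k ?h * W' a) = g ?h * k ?h * W' a"
          by (rule assoc_mult_mat[OF gh kh(1) ca(2), symmetric])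
        also have "\<dots> = W' a" unfolding kh(2) by (rule left_mult_one_mat[OF ca(2)])
        finally show "W' a * g ?t = g ?h * M' a" ..
      next
        assume *: "W' a * g ?t = g ?h * M' a"
        have "k ?h * W' a = k ?h * W' a * (g ?t * k ?t)"
          unfolding kt(2) by (rule right_mult_one_mat[OF mult_carrier_mat[OF kh(1) ca(2)], symmetric])
        also have "\<dots> = k ?h * (W' a * g ?t) * k ?t"
          by (rule mult_mat_assoc4[OF kh(1) ca(2) gt kt(1)])
        also have "\<dots> = k ?h * (g ?h * M' a) * k ?t" unfolding * ..
        also have "k ?h * (g ?h * M' a) = k ?h * g ?h * M' a"
          by (rule assoc_mult_mat[OF kh(1) gh ca(1), symmetric])
        also have "\<dots> = M' a" unfolding kh(3) by (rule left_mult_one_mat[OF ca(1)])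
        finally show "M' a * k ?t = k ?h * W' a" ..
      qed
    qed
    have "GL_act Q k W = M"
      using GL_act_eq_iff[OF kGL W R[OF M]] inverse[OF _ R[OF M] W] W_eq by blast
    then have "h' W \<noteq> 0" using h'(2) W h(2) by simp
    moreover have "h' V = 0" if V: "V \<in> ?R - ?O" for V
    proof (rule ccontr)
      \<comment> \<open>The translate \<open>U\<close> of \<open>V\<close> by \<open>k\<close> lies
        in the neighbourhood of \<open>M\<close>, so some \<open>l\<close> carries \<open>M\<close>
        to \<open>U\<close>; then the product of \<open>g\<close> and \<open>l\<close> carries
        \<open>M\<close> to \<open>V\<close>.\<close>
      assume "h' V \<noteq> 0"
      have Vc: "V \<in> rep_tuples Q \<beta>" using V R by blast
      define U where "U = GL_act Q k V"
      have U: "U \<in> ?R" unfolding U_def using V by (intro GL_act_Rep[OF kGL]) blast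
      note Uc = R[OF U]
      have "U \<in> ?O" using nbhd[OF U] h'(2) Vc \<open>h' V \<noteq> 0\<close> by (simp add: U_def)
      then obtain l where l: "l \<in> GL Q \<beta>" "U = GL_act Q l M" by (auto simp: GL_orbit_def)
      have lc: "l x \<in> carrier_mat (\<beta> x) (\<beta> x)" "det (l x) \<noteq> 0" if "x \<in> verts Q" for x
        using l(1) that by (auto simp: GL_iff)
      define m where "m = (\<lambda>x\<in>verts Q. g x * l x)"
      have mGL: "m \<in> GL Q \<beta>"
        using mult_carrier_mat[OF gc(1) lc(1)] lc(2) det_nonzero_if_invertible_mat[OF gc]
        by (auto simp: GL_iff m_def det_mult[OF gc(1) lc(1)])
      have "V a * m (tail Q a) = m (head Q a) * M a" if a: "a \<in> arcs Q" for a
      proof -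
        let ?h = "head Q a" and ?t = "tail Q a"
        have v: "?h \<in> verts Q" "?t \<in> verts Q" using a by auto
        note ca = rep_tuplesD[OF Vc a] rep_tuplesD[OF Uc a] rep_tuplesD[OF R[OF M] a]
        note gh = gc(1)[OF v(1)] and gt = gc(1)[OF v(2)] and lh = lc(1)[OF v(1)] and lt = lc(1)[OF v(2)]
        have "U a * k ?t = k ?h * V a" using GL_act_eq_iff[OF kGL Vc Uc] U_def a by blast
        then have Vg: "V a * g ?t = g ?h * U a" using inverse[OF a Uc Vc] by blast
        have Ul: "U a * l ?t = l ?h * M a" using GL_act_eq_iff[OF l(1) R[OF M] Uc] l(2) a by blast
        have "V a * (g ?t * l ?t) = V a * g ?t * l ?t" by (rule assoc_mult_mat[OF ca(1) gt lt, symmetric])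
        also have "\<dots> = g ?h * (U a * l ?t)" unfolding Vg by (rule assoc_mult_mat[OF gh ca(2) lt])
        also have "\<dots> = g ?h * l ?h * M a" unfolding Ul by (rule assoc_mult_mat[OF gh lh ca(3), symmetric])
        finally show ?thesis using v by (simp add: m_def)
      qed
      then have "GL_act Q m M = V" using GL_act_eq_iff[OF mGL R[OF M] Vc] by blast
      then show False using V mGL by (auto simp: GL_orbit_def)
    qed
    ultimately show ?thesis using h'(1) by (auto simp: P_def)
  qed
  then have "?R - ?O = {V \<in> ?R. \<forall>f\<in>P. f V = 0}" by (auto simp: P_def)
  then show ?thesis
    unfolding zariski_open_in_def zariski_closed_in_def using sub
    by (intro conjI exI[of _ P]) (auto simp: P_def)
qed

section \<open>The up-and-down graph\<close>

text \<open>In a finite graph of valency at most 2, a walk that never turns back closes up to a cycle,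
  which is then a whole component.\<close>

lemma not_no_bands_if_infinite_walk:
  fixes G :: "('w, 'e) pre_digraph"
  assumes G: "fin_digraph G"
    and no_loops: "\<And>f. f \<in> arcs G \<Longrightarrow> tail G f \<noteq> head G f"
    and valency: "\<And>w f1 f2 f3. f1 \<in> arcs G \<Longrightarrow> f2 \<in> arcs G \<Longrightarrow> f3 \<in> arcs G \<Longrightarrow>
      w \<in> {tail G f1, head G f1} \<Longrightarrow> w \<in> {tail G f2, head G f2} \<Longrightarrow> w \<in> {tail G f3, head G f3} \<Longrightarrow>
      f1 \<noteq> f2 \<Longrightarrow> f3 = f1 \<or> f3 = f2"
    and e: "\<And>n. e n \<in> arcs G"
    and ends: "\<And>n :: nat. {tail G (e n), head G (e n)} = {v n, v (Suc n)}"
    and turn: "\<And>n. e n \<noteq> e (Suc n)"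
  shows "\<not> no_bands G"
proof -
  interpret fin_digraph G by fact
  have v_verts: "v n \<in> verts G" for n
  proof -
    have "v n \<in> {tail G (e n), head G (e n)}" unfolding ends by simp
    then show ?thesis using head_in_verts[OF e] tail_in_verts[OF e] by auto
  qed
  have "\<not> inj v"
    using inj_on_finite[of v UNIV "verts G"] finite_verts v_verts by auto
  then have "\<exists>m n. m < n \<and> v m = v n" using linorder_injI[of v] by blast
  then obtain m n where "v m = v n" "m < n" by blast
  then have "0 < n - m" "v m = v (m + (n - m))" by simp_all
  \<comment> \<open>Some two visits \<open>d\<close> steps apart agree. Minimality of
    \<open>d\<close> over all starting points excludes shorter repetitions inside the closed
    walk.\<close>
  define P where "P d \<longleftrightarrow> d > 0 \<and> (\<exists>i. v i = v (i + d))" for d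
  have PI: "P d" if "d > 0" "v i = v (i + d)" for d i
    unfolding P_def using that by (intro conjI exI[of _ i])
  define d where "d = (LEAST d. P d)"
  have "P (n - m)" by (rule PI[of _ m]) fact+
  then have "P d" unfolding d_def by (rule LeastI)
  then obtain i where d: "d > 0" and i: "v i = v (i + d)"
    unfolding P_def by (elim conjE exE)
  define W where "W k = v (i + k)" for k
  define F where "F k = e (i + k)" for k
  have W_d: "W d = W 0" using i by (simp add: W_def)
  have W_neq: "W k \<noteq> W l" if "k < l" "l < d" for k l
  proof
    assume "W k = W l"
    then have "v (i + k) = v (i + k + (l - k))"
      using that(1) by (simp add: W_def)
    then have "P (l - k)" using PI[of "l - k" "i + k"] that(1) by simp
    then have "d \<le> l - k" unfolding d_def by (rule Least_le)
    then show False using that by linarith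
  qed
  have F: "F k \<in> arcs G" "{tail G (F k), head G (F k)} = {W k, W (Suc k)}" "F k \<noteq> F (Suc k)" for k
    using e ends turn by (auto simp: F_def W_def)
  \<comment> \<open>Equal edges have equal pairs of ends; distinctness of the vertices then makes
    the two edges consecutive, which \<open>turn\<close> forbids.\<close>
  have F_neq: "F k \<noteq> F l" if "k < l" "l < d" for k l
  proof
    assume "F k = F l"
    then have "{W k, W (Suc k)} = {W l, W (Suc l)}" using F(2) by metis
    then have "W (Suc k) = W l" using W_neq[OF that] by (auto simp: doubleton_eq_iff)
    then have "l = Suc k" using W_neq[of "Suc k" l] that by (cases "Suc k < l") auto
    then show False using \<open>F k = F l\<close> F(3) by blast
  qed
  define vs where "vs = map W [0..<d]"
  define es where "es = map F [0..<d]"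
  have sets: "set vs = W ` {..<d}" "set es = F ` {..<d}"
    by (auto simp: vs_def es_def)
  have W_in: "W k \<in> set vs" if "k \<le> d" for k
    using that W_d d by (cases "k = d") (auto simp: sets)
  \<comment> \<open>Every vertex of the cycle already carries two distinct edges of it, so the
    valency leaves room for no other.\<close>
  have closed: "f \<in> set es" if f: "f \<in> arcs G" "W k \<in> {tail G f, head G f}" and k: "k < d" for f k
  proof (cases k)
    case 0
    \<comment> \<open>At the starting vertex these are the first and the last edge. They coincide
      only for \<open>d = 1\<close>, where the edge would be a loop.\<close>
    have W0: "W 0 \<in> {tail G (F 0), head G (F 0)}" "W 0 \<in> {tail G (F (d - 1)), head G (F (d - 1))}"
      using F(2)[of 0] F(2)[of "d - 1"] d W_d by auto
    have "F 0 \<noteq> F (d - 1)"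
    proof (cases "d = 1")
      case True
      then show ?thesis using F(2)[of 0] W_d no_loops[OF F(1)[of 0]] by (simp add: doubleton_eq_iff)
    next
      case False
      then show ?thesis using F_neq[of 0 "d - 1"] d by simp
    qed
    then have "f = F 0 \<or> f = F (d - 1)"
      using valency[OF F(1) F(1) f(1) W0] f(2) 0 by blast
    then show ?thesis using d by (auto simp: sets)
  next
    case (Suc l)
    have "f = F l \<or> f = F k"
      using valency[OF F(1)[of l] F(1)[of k] f(1) _ _ f(2)] F(2)[of l] F(2)[of k] F(3)[of l] Suc
      by auto
    then show ?thesis using k Suc by (auto simp: sets)
  qed
  let ?S = "with_proj (mk_symmetric G)"
  let ?C = "{w. W 0 \<rightarrow>\<^sup>*\<^bsub>?S\<^esub> w}"
  have adj: "(u, w) \<in> arcs_ends ?S \<longleftrightarrow> (\<exists>f\<in>arcs G. {tail G f, head G f} = {u, w})" for u w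
    by (auto simp: parcs_mk_symmetric doubleton_eq_iff)
  have W_verts: "W k \<in> verts G" for k using v_verts by (simp add: W_def)
  have "w \<in> set vs" if "W 0 \<rightarrow>\<^sup>*\<^bsub>?S\<^esub> w" for w
    using that unfolding reachable_def
  proof (induction rule: rtrancl_on_induct)
    case base
    then show ?case using W_in by simp
  next
    case (step y z)
    then obtain f k where f: "f \<in> arcs G" "{tail G f, head G f} = {y, z}" "k < d" "y = W k"
      using adj sets by auto
    then have "f \<in> set es" using closed[of f k] by auto
    then obtain l where "l < d" "f = F l" using sets by auto
    then have "z \<in> {W l, W (Suc l)}" using F(2) f(2) by (metis insertCI)
    then show ?case using W_in[of l] W_in[of "Suc l"] \<open>l < d\<close> by auto
  qed
  moreover have "W 0 \<rightarrow>\<^sup>*\<^bsub>?S\<^esub> W k" for k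
  proof (induction k)
    case 0
    then show ?case using W_verts by (simp add: reachable_def)
  next
    case (Suc k)
    have "(W k, W (Suc k)) \<in> arcs_ends ?S" using adj F(1,2) by blast
    with Suc show ?case
      unfolding reachable_def using W_verts by (auto intro: rtrancl_on_into_rtrancl_on)
  qed
  ultimately have C: "?C = set vs" using sets by auto
  have "arcs (G \<restriction> ?C) = set es"
  proof
    show "arcs (G \<restriction> ?C) \<subseteq> set es"
      unfolding C using closed by (force simp: sets)
    show "set es \<subseteq> arcs (G \<restriction> ?C)"
    proof
      fix f assume "f \<in> set es"
      then obtain k where k: "k < d" "f = F k" using sets by auto
      then have "{tail G f, head G f} \<subseteq> set vs" using F(2) W_in[of k] W_in[of "Suc k"] by auto
      then show "f \<in> arcs (G \<restriction> ?C)" unfolding C using F(1) k by simp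
    qed
  qed
  moreover have "distinct vs" "distinct es"
    unfolding vs_def es_def distinct_map
    using W_neq F_neq by (auto simp: inj_on_def) (metis nat_neq_iff)+
  moreover have "{tail G (es ! k), head G (es ! k)} = {vs ! k, vs ! (Suc k mod length vs)}"
    if "k < length vs" for k
  proof (cases "Suc k = d")
    case True
    then show ?thesis using F(2)[of k] W_d d by (simp add: vs_def es_def)
  next
    case False
    then show ?thesis using F(2)[of k] that by (simp add: vs_def es_def)
  qed
  ultimately have "is_undirected_cycle (G \<restriction> ?C)"
    unfolding is_undirected_cycle_def using d C
    by (intro exI[of _ vs] exI[of _ es]) (auto simp: vs_def es_def)
  moreover have "G \<restriction> ?C \<in> undirected_components G"
    unfolding undirected_components_def using W_verts by blast
  ultimately show ?thesis unfolding no_bands_def by blast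
qed

text \<open>The combinatorial content of the hypotheses, free of the path algebra: at each vertex a
  color has at most one arrow in and one arrow out, ranks are bounded, and distinct colors have
  opposite signs.\<close>

locale up_and_down = fin_digraph Q for Q :: "('v, 'a) pre_digraph" +
  fixes c :: "'a \<Rightarrow> 's" and \<beta> :: "'v \<Rightarrow> nat" and r :: "'a \<Rightarrow> nat" and \<epsilon> :: "'v \<times> 's \<Rightarrow> int"
  assumes in_unique: "\<And>a b. a \<in> arcs Q \<Longrightarrow> b \<in> arcs Q \<Longrightarrow> head Q a = head Q b \<Longrightarrow> c a = c b \<Longrightarrow> a = b"
    and out_unique: "\<And>a b. a \<in> arcs Q \<Longrightarrow> b \<in> arcs Q \<Longrightarrow> tail Q a = tail Q b \<Longrightarrow> c a = c b \<Longrightarrow> a = b"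
    and rank_le: "\<And>a. a \<in> arcs Q \<Longrightarrow> r a \<le> \<beta> (tail Q a)" "\<And>a. a \<in> arcs Q \<Longrightarrow> r a \<le> \<beta> (head Q a)"
    and rank_add_le: "\<And>a b. a \<in> arcs Q \<Longrightarrow> b \<in> arcs Q \<Longrightarrow> head Q a = tail Q b \<Longrightarrow> c a = c b \<Longrightarrow>
      r a + r b \<le> \<beta> (head Q a)"
    and sign: "\<And>a x. a \<in> arcs Q \<Longrightarrow> x \<in> {tail Q a, head Q a} \<Longrightarrow> \<epsilon> (x, c a) = 1 \<or> \<epsilon> (x, c a) = - 1"
    and sign_opposite: "\<And>a b x. a \<in> arcs Q \<Longrightarrow> b \<in> arcs Q \<Longrightarrow> x \<in> {tail Q a, head Q a} \<Longrightarrow>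
      x \<in> {tail Q b, head Q b} \<Longrightarrow> c a \<noteq> c b \<Longrightarrow> \<epsilon> (x, c a) = - \<epsilon> (x, c b)"
begin

text \<open>With indices starting at 0, the \<open>i\<close>-th edge labeled \<open>a\<close> joins \<open>tail_pos a i\<close> to
  \<open>head_pos a i\<close>.\<close>

definition tail_pos :: "'a \<Rightarrow> nat \<Rightarrow> nat" where
  "tail_pos a i = (if \<epsilon> (tail Q a, c a) = 1 then i else \<beta> (tail Q a) - 1 - i)"

definition head_pos :: "'a \<Rightarrow> nat \<Rightarrow> nat" where
  "head_pos a i = (if \<epsilon> (head Q a, c a) = 1 then \<beta> (head Q a) - 1 - i else i)"

section \<open>Positions of edges and their order\<close>

lemma pos_less:
  assumes "a \<in> arcs Q" "i < r a"
  shows "tail_pos a i < \<beta> (tail Q a)" "head_pos a i < \<beta> (head Q a)"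
  using rank_le[OF assms(1)] assms(2) by (auto simp: tail_pos_def head_pos_def)

lemma pos_inj:
  assumes "a \<in> arcs Q" "i < r a" "j < r a"
  shows "tail_pos a i = tail_pos a j \<Longrightarrow> i = j" "head_pos a i = head_pos a j \<Longrightarrow> i = j"
  using rank_le[OF assms(1)] assms(2,3) by (auto simp: tail_pos_def head_pos_def split: if_splits)

text \<open>At a vertex the incoming and the outgoing arrow of one color count positions from
  opposite ends, and the rank inequality keeps the two ranges apart.\<close>

lemma head_pos_neq_tail_pos:
  assumes "a \<in> arcs Q" "b \<in> arcs Q" "head Q a = tail Q b" "c a = c b" "i < r a" "j < r b"
  shows "head_pos a i \<noteq> tail_pos b j"
  using rank_add_le[OF assms(1-4)] assms(3-6) by (auto simp: tail_pos_def head_pos_def)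

text \<open>\<open>tail_pos\<close> increases with the edge index if the sign is 1 and decreases if
  it is -1, while \<open>head_pos\<close> does the opposite. This contrast causes the change of sign
  when an equation is crossed.\<close>

lemma sgn_tail_pos:
  assumes "a \<in> arcs Q" "i < r a" "j < r a"
  shows "\<epsilon> (tail Q a, c a) * sgn (int (tail_pos a j) - int (tail_pos a i)) = sgn (int j - int i)"
  using rank_le[OF assms(1)] assms(2,3) sign[OF assms(1), of "tail Q a"]
  by (auto simp: tail_pos_def sgn_if)

lemma sgn_head_pos:
  assumes "a \<in> arcs Q" "i < r a" "j < r a"
  shows "\<epsilon> (head Q a, c a) * sgn (int (head_pos a j) - int (head_pos a i)) = - sgn (int j - int i)"
  using rank_le[OF assms(1)] assms(2,3) sign[OF assms(1), of "head Q a"]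
  by (auto simp: head_pos_def sgn_if)

lemma sgn_tail_pos_half:
  assumes "a \<in> arcs Q" "i < r a" "v < \<beta> (tail Q a)" "v \<notin> tail_pos a ` {..<r a}"
  shows "\<epsilon> (tail Q a, c a) * sgn (int v - int (tail_pos a i)) = 1"
proof (cases "\<epsilon> (tail Q a, c a) = 1")
  case True
  then have "\<not> v < r a" using assms(4) by (auto simp: tail_pos_def)
  then show ?thesis using True assms(2) by (simp add: tail_pos_def)
next
  case False
  have "v < \<beta> (tail Q a) - r a"
  proof (rule ccontr)
    assume "\<not> v < \<beta> (tail Q a) - r a"
    then have "\<beta> (tail Q a) - 1 - v < r a" "v = tail_pos a (\<beta> (tail Q a) - 1 - v)"
      using assms(3) rank_le[OF assms(1)] False by (auto simp: tail_pos_def)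
    then show False using assms(4) by blast
  qed
  then show ?thesis
    using False assms(2) sign[OF assms(1), of "tail Q a"] by (auto simp: tail_pos_def sgn_if)
qed

lemma sgn_head_pos_half:
  assumes "a \<in> arcs Q" "i < r a" "v < \<beta> (head Q a)" "v \<notin> head_pos a ` {..<r a}"
  shows "\<epsilon> (head Q a, c a) * sgn (int (head_pos a i) - int v) = 1"
proof (cases "\<epsilon> (head Q a, c a) = 1")
  case False
  then have "\<not> v < r a" using assms(4) by (auto simp: head_pos_def)
  then show ?thesis
    using False assms(2) sign[OF assms(1), of "head Q a"] by (auto simp: head_pos_def)
next
  case True
  have "v < \<beta> (head Q a) - r a"
  proof (rule ccontr)
    assume "\<not> v < \<beta> (head Q a) - r a"
    then have "\<beta> (head Q a) - 1 - v < r a" "v = head_pos a (\<beta> (head Q a) - 1 - v)"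
      using assms(3) rank_le[OF assms(1)] True by (auto simp: head_pos_def)
    then show False using assms(4) by blast
  qed
  then show ?thesis
    using True assms(2) by (auto simp: head_pos_def sgn_if)
qed

text \<open>Distinct colors at a vertex have opposite signs, and of three signs two agree.\<close>

lemma two_colors:
  assumes "a1 \<in> arcs Q" "a2 \<in> arcs Q" "a3 \<in> arcs Q"
    and "x \<in> {tail Q a1, head Q a1}" "x \<in> {tail Q a2, head Q a2}" "x \<in> {tail Q a3, head Q a3}"
    and "c a1 \<noteq> c a2"
  shows "c a3 = c a1 \<or> c a3 = c a2"
proof (rule ccontr)
  assume "\<not> ?thesis"
  then have "\<epsilon> (x, c a3) = - \<epsilon> (x, c a1)" "\<epsilon> (x, c a3) = - \<epsilon> (x, c a2)"
    using sign_opposite[OF assms(3,1,6,4)] sign_opposite[OF assms(3,2,6,5)] by auto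
  then show False
    using sign_opposite[OF assms(1,2,4,5,7)] sign[OF assms(1,4)] by auto
qed

section \<open>Edges and valency of the graph\<close>

abbreviation "\<Gamma> \<equiv> ud_graph Q c \<beta> r \<epsilon>"

lemma arcs_ud_graph: "arcs \<Gamma> = {(a, Suc i) | a i. a \<in> arcs Q \<and> i < r a}"
  by (auto simp: ud_graph_def) (metis Suc_le_D Suc_le_lessD One_nat_def)

lemma ud_graph_ends:
  assumes "a \<in> arcs Q" "i < r a"
  shows "tail \<Gamma> (a, Suc i) = (tail Q a, Suc (tail_pos a i))"
    "head \<Gamma> (a, Suc i) = (head Q a, Suc (head_pos a i))"
  using rank_le[OF assms(1)] assms(2) by (auto simp: ud_graph_def tail_pos_def head_pos_def)

lemma fin_digraph_ud_graph: "fin_digraph \<Gamma>"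
proof
  show "tail \<Gamma> e \<in> verts \<Gamma>" "head \<Gamma> e \<in> verts \<Gamma>" if e: "e \<in> arcs \<Gamma>" for e
  proof -
    obtain a i where "e = (a, Suc i)" "a \<in> arcs Q" "i < r a" using e arcs_ud_graph by auto
    then show "tail \<Gamma> e \<in> verts \<Gamma>" "head \<Gamma> e \<in> verts \<Gamma>"
      using ud_graph_ends[of a i] pos_less[of a i] by (auto simp: ud_graph_def)
  qed
  have "arcs \<Gamma> \<subseteq> Sigma (arcs Q) (\<lambda>a. {..r a})" "verts \<Gamma> \<subseteq> Sigma (verts Q) (\<lambda>x. {..\<beta> x})"
    by (auto simp: ud_graph_def)
  then show "finite (arcs \<Gamma>)" "finite (verts \<Gamma>)"
    by (meson finite_SigmaI finite_arcs finite_verts finite_atMost finite_subset)+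
qed

text \<open>Two edges of one color at a vertex of \<Gamma> would need two arrows of that color into
  or out of the same point, a repeated position, or an overlap of head and tail positions.\<close>

lemma ud_graph_edge_unique:
  assumes a: "a \<in> arcs Q" "i < r a" and b: "b \<in> arcs Q" "j < r b"
    and w: "w \<in> {tail \<Gamma> (a, Suc i), head \<Gamma> (a, Suc i)}" "w \<in> {tail \<Gamma> (b, Suc j), head \<Gamma> (b, Suc j)}"
    and color: "c a = c b"
  shows "a = b \<and> i = j"
  using w unfolding ud_graph_ends[OF a] ud_graph_ends[OF b]
  using pos_inj[OF a, of j] in_unique[OF a(1) b(1) _ color] out_unique[OF a(1) b(1) _ color]
    head_pos_neq_tail_pos[OF a(1) b(1) _ color a(2) b(2)] b(2)
    head_pos_neq_tail_pos[OF b(1) a(1) _ color[symmetric] b(2) a(2)]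
  by auto

lemma ud_graph_valency:
  assumes "e1 \<in> arcs \<Gamma>" "e2 \<in> arcs \<Gamma>" "e3 \<in> arcs \<Gamma>"
    and w: "w \<in> {tail \<Gamma> e1, head \<Gamma> e1}" "w \<in> {tail \<Gamma> e2, head \<Gamma> e2}" "w \<in> {tail \<Gamma> e3, head \<Gamma> e3}"
    and "e1 \<noteq> e2"
  shows "e3 = e1 \<or> e3 = e2"
proof -
  obtain a1 i1 a2 i2 a3 i3 where
    e: "e1 = (a1, Suc i1)" "e2 = (a2, Suc i2)" "e3 = (a3, Suc i3)"
    and a: "a1 \<in> arcs Q" "i1 < r a1" "a2 \<in> arcs Q" "i2 < r a2" "a3 \<in> arcs Q" "i3 < r a3"
    using assms(1-3) arcs_ud_graph by auto
  note eq = ud_graph_edge_unique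
  have x: "fst w \<in> {tail Q a1, head Q a1}" "fst w \<in> {tail Q a2, head Q a2}"
    "fst w \<in> {tail Q a3, head Q a3}"
    using w unfolding e ud_graph_ends[OF a(1,2)] ud_graph_ends[OF a(3,4)] ud_graph_ends[OF a(5,6)]
    by auto
  have "c a1 \<noteq> c a2"
    using eq[OF a(1-4) w(1,2)[unfolded e]] \<open>e1 \<noteq> e2\<close> e by auto
  then have "c a3 = c a1 \<or> c a3 = c a2"
    using two_colors[OF a(1,3,5) x] by blast
  then show ?thesis
    using eq[OF a(5,6,1,2) w(3,1)[unfolded e]] eq[OF a(5,6,3,4) w(3,2)[unfolded e]] e by auto
qed

lemma ud_graph_no_loops:
  assumes "e \<in> arcs \<Gamma>"
  shows "tail \<Gamma> e \<noteq> head \<Gamma> e"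
proof -
  obtain a i where a: "e = (a, Suc i)" "a \<in> arcs Q" "i < r a" using assms arcs_ud_graph by auto
  show ?thesis
    unfolding a(1) ud_graph_ends[OF a(2,3)]
    using head_pos_neq_tail_pos[OF a(2) a(2) _ _ a(3) a(3)] by auto
qed

section \<open>Endomorphisms of the up-and-down module\<close>

text \<open>The entries of the up-and-down module with indices starting at 0, \<open>w\<close> at
  the head and \<open>u\<close> at the tail, without reference to matrix dimensions.\<close>

definition M_entry :: "'a \<Rightarrow> nat \<Rightarrow> nat \<Rightarrow> 'k::field" where
  "M_entry a w u = (if \<exists>i<r a. w = head_pos a i \<and> u = tail_pos a i then 1 else 0)"

text \<open>The failure of \<open>f : M \<rightarrow> M\<close> (with \<open>f x u v\<close> the coefficient of \<open>e\<^sub>u\<close> in \<open>f(e\<^sub>v)\<close>) to commute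
  with the arrow \<open>a\<close>.\<close>

definition commutator :: "('v \<Rightarrow> nat \<Rightarrow> nat \<Rightarrow> 'k::field) \<Rightarrow> 'a \<times> nat \<times> nat \<Rightarrow> 'k" where
  "commutator f = (\<lambda>(a, w, v). (\<Sum>u<\<beta> (tail Q a). M_entry a w u * f (tail Q a) u v) -
     (\<Sum>u<\<beta> (head Q a). f (head Q a) w u * M_entry a u v))"

text \<open>The entries of the commutator that determine all the others.\<close>

definition equations :: "('a \<times> nat \<times> nat) set" where
  "equations = {(a, w, v). a \<in> arcs Q \<and> w < \<beta> (head Q a) \<and> v < \<beta> (tail Q a) \<and>
     (\<forall>b\<in>arcs Q. tail Q b = head Q a \<and> c b = c a \<longrightarrow> w \<notin> tail_pos b ` {..<r b}) \<and>
     (w \<in> head_pos a ` {..<r a} \<or> v \<in> tail_pos a ` {..<r a})}"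

text \<open>The unknown \<open>f x u0 v0\<close> occurs in the equation through the product of
  \<open>M\<close> with \<open>f\<close>.\<close>

definition out_equation :: "'v \<Rightarrow> nat \<Rightarrow> nat \<Rightarrow> 'a \<times> nat \<times> nat \<Rightarrow> bool" where
  "out_equation x u0 v0 = (\<lambda>(a, w, v).
    tail Q a = x \<and> v = v0 \<and> (\<exists>i<r a. w = head_pos a i \<and> u0 = tail_pos a i))"

text \<open>Occurrence in the product of \<open>f\<close> with \<open>M\<close>, which the
  commutator subtracts.\<close>

definition in_equation :: "'v \<Rightarrow> nat \<Rightarrow> nat \<Rightarrow> 'a \<times> nat \<times> nat \<Rightarrow> bool" where
  "in_equation x u0 v0 = (\<lambda>(a, w, v).
    head Q a = x \<and> w = u0 \<and> (\<exists>i<r a. v0 = head_pos a i \<and> v = tail_pos a i))"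

definition coeff_at :: "'v \<Rightarrow> nat \<Rightarrow> nat \<Rightarrow> 'a \<times> nat \<times> nat \<Rightarrow> 'k::field" where
  "coeff_at x u0 v0 e =
    (if out_equation x u0 v0 e then 1 else 0) - (if in_equation x u0 v0 e then 1 else 0)"

definition unit_at :: "'v \<Rightarrow> nat \<Rightarrow> nat \<Rightarrow> 'v \<Rightarrow> nat \<Rightarrow> nat \<Rightarrow> 'k::field" where
  "unit_at x u0 v0 y u v = (if y = x \<and> u = u0 \<and> v = v0 then 1 else 0)"

lemma commutator_add:
  "commutator (\<lambda>x u v. f x u v + g x u v) e = commutator f e + commutator g e"
  by (cases e) (simp add: commutator_def algebra_simps sum.distrib)

lemma commutator_uminus:
  "commutator (\<lambda>x u v. - f x u v) e = - commutator f e"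
  by (cases e) (simp add: commutator_def sum_negf)

text \<open>The value of a linear map at a unit vector is a column of its matrix, so
  \<open>coeff_at\<close> is the coefficient matrix of the system at \<open>M\<close>.\<close>

lemma commutator_unit_at:
  assumes "u0 < \<beta> x" "v0 < \<beta> x"
  shows "commutator (unit_at x u0 v0) e = coeff_at x u0 v0 e"
proof -
  obtain a w v where e: "e = (a, w, v)" by (cases e)
  have "(\<Sum>u<\<beta> (tail Q a). M_entry a w u * unit_at x u0 v0 (tail Q a) u v) =
      (\<Sum>u<\<beta> (tail Q a). if u = u0 then (if tail Q a = x \<and> v = v0 then M_entry a w u0 else 0) else 0)"
    by (intro sum.cong) (auto simp: unit_at_def)
  also have "\<dots> = (if out_equation x u0 v0 (a, w, v) then 1 else 0)"
    using assms by (auto simp: out_equation_def M_entry_def)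
  finally have out: "(\<Sum>u<\<beta> (tail Q a). M_entry a w u * unit_at x u0 v0 (tail Q a) u v) =
      (if out_equation x u0 v0 (a, w, v) then 1 else (0 :: 'b))" .
  have "(\<Sum>u<\<beta> (head Q a). unit_at x u0 v0 (head Q a) w u * M_entry a u v) =
      (\<Sum>u<\<beta> (head Q a). if u = v0 then (if head Q a = x \<and> w = u0 then M_entry a v0 v else 0) else 0)"
    by (intro sum.cong) (auto simp: unit_at_def)
  also have "\<dots> = (if in_equation x u0 v0 (a, w, v) then 1 else 0)"
    using assms by (auto simp: in_equation_def M_entry_def)
  finally show ?thesis by (simp add: commutator_def coeff_at_def out e)
qed

text \<open>Two occurrences of the same type come from the same arrow and the same edge. Occurrences
  of different types are excluded by the condition in \<open>equations\<close> that the row is no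
  tail position of an outgoing arrow of the same color.\<close>

lemma equation_unique:
  assumes e: "(a, w, v) \<in> equations" "(a', w', v') \<in> equations" and color: "c a = c a'"
    and "out_equation x u0 v0 (a, w, v) \<or> in_equation x u0 v0 (a, w, v)"
    and "out_equation x u0 v0 (a', w', v') \<or> in_equation x u0 v0 (a', w', v')"
  shows "a = a' \<and> w = w' \<and> v = v' \<and>
    \<not> (out_equation x u0 v0 (a, w, v) \<and> in_equation x u0 v0 (a', w', v'))"
proof -
  have arcs: "a \<in> arcs Q" "a' \<in> arcs Q" using e by (auto simp: equations_def)
  have mixed: False
    if "out_equation x u0 v0 (a1, w1, v1)" "in_equation x u0 v0 (a2, w2, v2)" "c a1 = c a2"
      "a1 \<in> arcs Q" "(a2, w2, v2) \<in> equations"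
    for a1 w1 v1 a2 w2 v2
    using that by (auto simp: out_equation_def in_equation_def equations_def)
  consider "out_equation x u0 v0 (a, w, v)" "out_equation x u0 v0 (a', w', v')"
    | "in_equation x u0 v0 (a, w, v)" "in_equation x u0 v0 (a', w', v')"
    using assms(4,5) mixed[OF _ _ color arcs(1) e(2)] mixed[OF _ _ color[symmetric] arcs(2) e(1)]
    by blast
  then have "a = a' \<and> w = w' \<and> v = v'"
  proof cases
    case 1
    then have "a = a'" using out_unique[OF arcs _ color] by (auto simp: out_equation_def)
    then show ?thesis using 1 pos_inj(1)[OF arcs(1)] by (auto simp: out_equation_def)
  next
    case 2
    then have "a = a'" using in_unique[OF arcs _ color] by (auto simp: in_equation_def)
    then show ?thesis using 2 pos_inj(2)[OF arcs(1)] by (auto simp: in_equation_def)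
  qed
  then show ?thesis using mixed[OF _ _ color arcs(1) e(2)] by blast
qed

lemma coeff_at_eq:
  assumes "e \<in> equations"
  shows "out_equation x u v e \<Longrightarrow> coeff_at x u v e = 1"
    and "in_equation x u v e \<Longrightarrow> coeff_at x u v e = - 1"
    and "coeff_at x u v e \<noteq> 0 \<longleftrightarrow> out_equation x u v e \<or> in_equation x u v e"
proof -
  obtain a w z where e: "e = (a, w, z)" by (cases e)
  have "\<not> (out_equation x u v e \<and> in_equation x u v e)"
    using equation_unique[of a w z a w z x u v] assms e by blast
  then show "out_equation x u v e \<Longrightarrow> coeff_at x u v e = 1"
    "in_equation x u v e \<Longrightarrow> coeff_at x u v e = - 1"
    "coeff_at x u v e \<noteq> 0 \<longleftrightarrow> out_equation x u v e \<or> in_equation x u v e"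
    by (auto simp: coeff_at_def)
qed

section \<open>Walks of unknowns through the equations\<close>

lemma coeff_at_unique:
  assumes "e \<in> equations" "e' \<in> equations" "c (fst e) = c (fst e')"
    and "coeff_at x u v e \<noteq> 0" "coeff_at x u v e' \<noteq> 0"
  shows "e = e'"
  using equation_unique[of "fst e" "fst (snd e)" "snd (snd e)" "fst e'" "fst (snd e')" "snd (snd e')" x u v]
    assms coeff_at_eq(3)[OF assms(1), of x u v] coeff_at_eq(3)[OF assms(2), of x u v]
  by (auto simp: prod_eq_iff)

lemma coeff_at_incident:
  assumes "e \<in> equations" "coeff_at x u v e \<noteq> 0"
  shows "fst e \<in> arcs Q" "x \<in> {tail Q (fst e), head Q (fst e)}"
  using assms coeff_at_eq(3)[OF assms(1), of x u v]
  by (auto simp: equations_def out_equation_def in_equation_def)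

text \<open>Crossing an equation reverses \<open>\<epsilon> \<cdot> sgn (v - u)\<close>, and this number is 1 where an equation has only
  one unknown.\<close>

lemma cross_equation:
  fixes e u v x
  defines "a \<equiv> fst e"
  assumes uv: "u < \<beta> x" "v < \<beta> x" and e: "e \<in> equations" "coeff_at x u v e \<noteq> (0 :: 'k::field)"
    and sgn: "\<epsilon> (x, c a) * sgn (int v - int u) \<noteq> 1"
  obtains y u' v' i where "u' < \<beta> y" "v' < \<beta> y" "i < r a" "y \<in> {tail Q a, head Q a}"
    "{(tail Q a, tail_pos a i), (head Q a, head_pos a i)} = {(x, u), (y, u')}"
    "coeff_at y u' v' e = - (coeff_at x u v e :: 'k)"
    "\<epsilon> (y, c a) * sgn (int v' - int u') = - (\<epsilon> (x, c a) * sgn (int v - int u))"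
proof -
  obtain w z where e_eq: "e = (a, w, z)" unfolding a_def by (cases e) auto
  have a: "a \<in> arcs Q" using e(1) e_eq by (auto simp: equations_def)
  show thesis
  proof (cases "out_equation x u v e")
    case True
    then obtain i where i: "tail Q a = x" "z = v" "i < r a" "w = head_pos a i" "u = tail_pos a i"
      unfolding e_eq out_equation_def by auto
    have "v \<in> tail_pos a ` {..<r a}"
      using sgn_tail_pos_half[OF a i(3), of v] uv sgn i by auto
    then obtain j where j: "j < r a" "v = tail_pos a j" by auto
    have "in_equation (head Q a) w (head_pos a j) e"
      unfolding e_eq in_equation_def using i j by auto
    then have "coeff_at (head Q a) w (head_pos a j) e = - (coeff_at x u v e :: 'k)"
      using coeff_at_eq(1,2)[OF e(1)] True by metis
    then show thesis
      using that[of w "head Q a" "head_pos a j" i] i j pos_less[OF a] sgn_tail_pos[OF a i(3) j(1)]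
        sgn_head_pos[OF a i(3) j(1)] by simp
  next
    case False
    then have inn: "in_equation x u v e" using e coeff_at_eq(3)[OF e(1)] by blast
    then obtain j where j: "head Q a = x" "w = u" "j < r a" "v = head_pos a j" "z = tail_pos a j"
      unfolding e_eq in_equation_def by auto
    have "u \<in> head_pos a ` {..<r a}"
      using sgn_head_pos_half[OF a j(3), of u] uv sgn j by auto
    then obtain i where i: "i < r a" "u = head_pos a i" by auto
    have "out_equation (tail Q a) (tail_pos a i) z e"
      unfolding e_eq out_equation_def using i j by auto
    then have "coeff_at (tail Q a) (tail_pos a i) z e = - (coeff_at x u v e :: 'k)"
      using coeff_at_eq(1,2)[OF e(1)] inn by (metis minus_minus)
    then show thesis
      using that[of "tail_pos a i" "tail Q a" z i] i j pos_less[OF a] sgn_tail_pos[OF a i(1) j(3)]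
        sgn_head_pos[OF a i(1) j(3)] by (simp add: insert_commute)
  qed
qed

text \<open>The task at an unknown is to solve the system whose right side is its column, restricted
  to the color of \<open>a\<close>. Its unit vector can fail only at an equation of another color.
  Crossing that equation gives an unknown whose own task, if solvable, would correct the
  failure.\<close>

lemma extend_walk:
  assumes uv: "u < \<beta> x" "v < \<beta> x" and a: "a \<in> arcs Q" "x \<in> {tail Q a, head Q a}"
    and sgn: "\<epsilon> (x, c a) * sgn (int v - int u) \<ge> 0"
    and unsolvable: "\<nexists>f. \<forall>e\<in>equations. commutator f e =
      (if c (fst e) = c a then coeff_at x u v e else (0 :: 'k::field))"
  obtains y u' v' b i where "u' < \<beta> y" "v' < \<beta> y" "b \<in> arcs Q" "y \<in> {tail Q b, head Q b}"
    "\<epsilon> (y, c b) * sgn (int v' - int u') \<ge> 0"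
    "\<nexists>f. \<forall>e\<in>equations. commutator f e =
      (if c (fst e) = c b then coeff_at y u' v' e else (0 :: 'k))"
    "i < r b" "{(tail Q b, tail_pos b i), (head Q b, head_pos b i)} = {(x, u), (y, u')}" "c b \<noteq> c a"
proof -
  let ?k = "\<lambda>e. coeff_at x u v e :: 'k"
  obtain e0 where e0: "e0 \<in> equations" "?k e0 \<noteq> 0" "c (fst e0) \<noteq> c a"
    using unsolvable commutator_unit_at[OF uv] by metis
  let ?b = "fst e0"
  note b = coeff_at_incident[OF e0(1,2)]
  \<comment> \<open>The sign changes from one color to the other at \<open>x\<close> and once more
    in crossing the equation, so the number is again nonnegative for the new color.\<close>
  have eps: "\<epsilon> (x, c ?b) = - \<epsilon> (x, c a)" using sign_opposite[OF b(1) a(1) b(2) a(2) e0(3)] .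
  then have "\<epsilon> (x, c ?b) * sgn (int v - int u) \<noteq> 1" using sgn by auto
  from cross_equation[OF uv e0(1,2) this] obtain y u' v' i where
    y: "u' < \<beta> y" "v' < \<beta> y" "i < r ?b" "y \<in> {tail Q ?b, head Q ?b}"
      "{(tail Q ?b, tail_pos ?b i), (head Q ?b, head_pos ?b i)} = {(x, u), (y, u')}"
    and k: "coeff_at y u' v' e0 = - ?k e0"
    and eps': "\<epsilon> (y, c ?b) * sgn (int v' - int u') = - (\<epsilon> (x, c ?b) * sgn (int v - int u))" .
  let ?k' = "\<lambda>e. coeff_at y u' v' e :: 'k"
  have "\<nexists>f. \<forall>e\<in>equations. commutator f e = (if c (fst e) = c ?b then ?k' e else 0)"
  proof
    assume "\<exists>f. \<forall>e\<in>equations. commutator f e = (if c (fst e) = c ?b then ?k' e else 0)"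
    then obtain f where f: "\<forall>e\<in>equations. commutator f e = (if c (fst e) = c ?b then ?k' e else 0)"
      by blast
    \<comment> \<open>\<open>f\<close> cancels the contribution of the unit vector in the color of
      \<open>?b\<close>, which sits in \<open>e0\<close> alone.\<close>
    let ?g = "\<lambda>z i j. unit_at x u v z i j + f z i j"
    have "commutator ?g e = (if c (fst e) = c a then ?k e else 0)" if e: "e \<in> equations" for e
    proof -
      have g: "commutator ?g e = ?k e + (if c (fst e) = c ?b then ?k' e else 0)"
        unfolding commutator_add commutator_unit_at[OF uv] using f e by simp
      consider "c (fst e) = c a" | "c (fst e) = c ?b" | "c (fst e) \<noteq> c a" "c (fst e) \<noteq> c ?b" by blast
      then show ?thesis
      proof cases
        case 1
        then show ?thesis using g e0(3) by simp
      next
        case 2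
        have "?k e + ?k' e = 0"
        proof (cases "e = e0")
          case False
          have "?k' e0 \<noteq> 0" using k e0(2) by simp
          then have "?k e = 0" "?k' e = 0"
            using coeff_at_unique[OF e e0(1) 2] e0(2) False by blast+
          then show ?thesis by simp
        qed (simp add: k)
        then show ?thesis using g 2 e0(3) by simp
      next
        case 3
        have "?k e = 0"
        proof (rule ccontr)
          assume "?k e \<noteq> 0"
          from coeff_at_incident[OF e this] show False
            using two_colors[OF a(1) b(1) _ a(2) b(2)] e0(3) 3 by metis
        qed
        then show ?thesis using g 3 by simp
      qed
    qed
    then show False using unsolvable by blast
  qed
  moreover have "\<epsilon> (y, c ?b) * sgn (int v' - int u') \<ge> 0" using eps' eps sgn by simp
  ultimately show thesis using that[of u' y v' ?b i] y b e0(3) by blast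
qed

text \<open>A failure could be extended forever by \<open>extend_walk\<close>; the first vertices of
  the pairs would form an infinite walk in \<Gamma> that never turns back, which forces a
  band.\<close>

lemma solvable:
  assumes no_bands: "no_bands \<Gamma>"
    and uv: "u < \<beta> x" "v < \<beta> x" and a: "a \<in> arcs Q" "x \<in> {tail Q a, head Q a}"
    and sgn: "\<epsilon> (x, c a) * sgn (int v - int u) \<ge> 0"
  shows "\<exists>f. \<forall>e\<in>equations. commutator f e =
    (if c (fst e) = c a then coeff_at x u v e else (0 :: 'k::field))"
proof (rule ccontr)
  assume unsolvable: "\<not> ?thesis"
  define P where "P = (\<lambda>(x, u, v, a). u < \<beta> x \<and> v < \<beta> x \<and> a \<in> arcs Q \<and> x \<in> {tail Q a, head Q a} \<and>
    \<epsilon> (x, c a) * sgn (int v - int u) \<ge> 0 \<and>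
    (\<nexists>f. \<forall>e\<in>equations. commutator f e =
      (if c (fst e) = c a then coeff_at x u v e else (0 :: 'k))))"
  \<comment> \<open>Of the pair of vertices only \<open>u\<close> is tracked. The change of color is
    recorded because it keeps the walk from turning back.\<close>
  define R where "R = (\<lambda>(x, u :: nat, v :: nat, a) (y, u', v' :: nat, b). \<exists>i<r b. c b \<noteq> c a \<and>
    {(tail Q b, tail_pos b i), (head Q b, head_pos b i)} = {(x, u), (y, u')})"
  have "\<exists>t. P t \<and> R s t" if "P s" for s
  proof -
    obtain x u v a where s: "s = (x, u, v, a)" by (cases s)
    from that have "u < \<beta> x" "v < \<beta> x" "a \<in> arcs Q" "x \<in> {tail Q a, head Q a}"
      "\<epsilon> (x, c a) * sgn (int v - int u) \<ge> 0"
      "\<nexists>f. \<forall>e\<in>equations. commutator f e =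
        (if c (fst e) = c a then coeff_at x u v e else (0 :: 'k))"
      unfolding s P_def by auto
    from extend_walk[OF this] obtain y u' v' b i where
      "u' < \<beta> y" "v' < \<beta> y" "b \<in> arcs Q" "y \<in> {tail Q b, head Q b}"
      "\<epsilon> (y, c b) * sgn (int v' - int u') \<ge> 0"
      "\<nexists>f. \<forall>e\<in>equations. commutator f e =
        (if c (fst e) = c b then coeff_at y u' v' e else (0 :: 'k))"
      "i < r b" "{(tail Q b, tail_pos b i), (head Q b, head_pos b i)} = {(x, u), (y, u')}" "c b \<noteq> c a" .
    then have "P (y, u', v', b)" "R s (y, u', v', b)"
      unfolding P_def R_def s by auto
    then show ?thesis by blast
  qed
  moreover have "P (x, u, v, a)" unfolding P_def using uv a sgn unsolvable by auto
  ultimately obtain S where S: "\<And>n. P (S n)" "\<And>n. R (S n) (S (Suc n))"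
    using dependent_nat_choice[of "\<lambda>_. P" "\<lambda>_. R"] by blast
  define X U A where "X n = fst (S n)" and "U n = fst (snd (S n))" and "A n = snd (snd (snd (S n)))" for n
  have arcs: "A n \<in> arcs Q" for n
    using S(1)[of n] by (auto simp: P_def A_def split: prod.splits)
  have "\<exists>i<r (A (Suc n)). c (A (Suc n)) \<noteq> c (A n) \<and>
    {(tail Q (A (Suc n)), tail_pos (A (Suc n)) i), (head Q (A (Suc n)), head_pos (A (Suc n)) i)} =
    {(X n, U n), (X (Suc n), U (Suc n))}" for n
    using S(2)[of n] by (simp add: R_def X_def U_def A_def split: prod.splits)
  then obtain I where I: "\<And>n. I n < r (A (Suc n))" "\<And>n. c (A (Suc n)) \<noteq> c (A n)"
    "\<And>n. {(tail Q (A (Suc n)), tail_pos (A (Suc n)) (I n)),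
      (head Q (A (Suc n)), head_pos (A (Suc n)) (I n))} = {(X n, U n), (X (Suc n), U (Suc n))}"
    by metis
  define E W where "E n = (A (Suc n), Suc (I n))" and "W n = (X n, Suc (U n))" for n
  have "\<not> no_bands \<Gamma>"
  proof (rule not_no_bands_if_infinite_walk[OF fin_digraph_ud_graph ud_graph_no_loops ud_graph_valency])
    show "E n \<in> arcs \<Gamma>" for n using arcs I(1) by (auto simp: arcs_ud_graph E_def)
    show "E n \<noteq> E (Suc n)" for n using I(2)[of "Suc n"] by (auto simp: E_def)
    show "{tail \<Gamma> (E n), head \<Gamma> (E n)} = {W n, W (Suc n)}" for n
      \<comment> \<open>Positions start at 0 and vertices of \<Gamma> at 1, hence the shift by
        \<open>Suc\<close>.\<close>
      using arg_cong[OF I(3)[of n], of "image (map_prod id Suc)"]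
      by (simp add: E_def W_def ud_graph_ends[OF arcs I(1)])
  qed
  then show False using no_bands by blast
qed

text \<open>Some unknown in \<open>e0\<close> satisfies the sign condition of
  \<open>solvable\<close>. In the color of \<open>e0\<close> its column meets \<open>e0\<close>
  alone, with coefficient 1 or -1. Together these families show that the equations are independent
  at \<open>M\<close>.\<close>

theorem commutator_right_inverse:
  assumes no_bands: "no_bands \<Gamma>" and e0: "e0 \<in> equations"
  shows "\<exists>f. \<forall>e\<in>equations. commutator f e = (if e = e0 then 1 else (0 :: 'k::field))"
proof -
  obtain a w v where e0_eq: "e0 = (a, w, v)" by (cases e0)
  have a: "a \<in> arcs Q" and wv: "w < \<beta> (head Q a)" "v < \<beta> (tail Q a)"
    using e0 by (auto simp: e0_eq equations_def)
  have solve: ?thesis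
    if n: "p < \<beta> x" "q < \<beta> x" "x \<in> {tail Q a, head Q a}" "coeff_at x p q e0 \<noteq> (0 :: 'k)"
      and sgn: "\<epsilon> (x, c a) * sgn (int q - int p) \<ge> 0" for x p q
  proof -
    obtain f where f: "\<forall>e\<in>equations. commutator f e =
        (if c (fst e) = c a then coeff_at x p q e else (0 :: 'k))"
      using solvable[OF no_bands n(1,2) a n(3) sgn] by blast
    have eq: "commutator f e = (if e = e0 then coeff_at x p q e0 else 0)" if "e \<in> equations" for e
      using f that coeff_at_unique[OF that e0, of x p q] n(4) e0_eq by auto
    have "coeff_at x p q e0 = (1 :: 'k) \<or> coeff_at x p q e0 = (- 1 :: 'k)"
      using coeff_at_eq[OF e0, of x p q] n(4) by blast
    then show ?thesis
    proof
      assume "coeff_at x p q e0 = (1 :: 'k)"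
      then show ?thesis using eq by (intro exI[of _ f]) simp
    next
      assume "coeff_at x p q e0 = (- 1 :: 'k)"
      then show ?thesis using eq
        by (intro exI[of _ "\<lambda>x i j. - f x i j"]) (simp add: commutator_uminus)
    qed
  qed
  have out: "coeff_at (tail Q a) (tail_pos a i) v e0 \<noteq> (0 :: 'k)" if "i < r a" "w = head_pos a i" for i
    using that coeff_at_eq(3)[OF e0] by (auto simp: e0_eq out_equation_def)
  have inn: "coeff_at (head Q a) w (head_pos a j) e0 \<noteq> (0 :: 'k)" if "j < r a" "v = tail_pos a j" for j
    using that coeff_at_eq(3)[OF e0] by (auto simp: e0_eq in_equation_def)
  have "(\<exists>i<r a. w = head_pos a i) \<or> (\<exists>j<r a. v = tail_pos a j)"
    using e0 by (auto simp: e0_eq equations_def)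
  then consider (both) i j where "i < r a" "w = head_pos a i" "j < r a" "v = tail_pos a j"
    | (out) i where "i < r a" "w = head_pos a i" "\<nexists>j. j < r a \<and> v = tail_pos a j"
    | (inn) j where "j < r a" "v = tail_pos a j" "\<nexists>i. i < r a \<and> w = head_pos a i"
    by blast
  then show ?thesis
  proof cases
    case both
    show ?thesis
    \<comment> \<open>The signed differences at the two unknowns are opposite; comparing the edge
      indices picks a nonnegative one.\<close>
    proof (cases "i \<le> j")
      case True
      have "\<epsilon> (tail Q a, c a) * sgn (int v - int (tail_pos a i)) \<ge> 0"
        using sgn_tail_pos[OF a both(1,3)] both(4) True by (simp add: sgn_if)
      then show ?thesis by (rule solve[OF pos_less(1)[OF a both(1)] wv(2) insertI1 out[OF both(1,2)]])
    next
      case False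
      have "\<epsilon> (head Q a, c a) * sgn (int (head_pos a j) - int w) \<ge> 0"
        using sgn_head_pos[OF a both(1,3)] both(2) False by (simp add: sgn_if)
      then show ?thesis by (rule solve[OF wv(1) pos_less(2)[OF a both(3)] insertI2[OF singletonI] inn[OF both(3,4)]])
    qed
  next
    case out': out
    have "\<epsilon> (tail Q a, c a) * sgn (int v - int (tail_pos a i)) \<ge> 0"
      using sgn_tail_pos_half[OF a out'(1) wv(2)] out'(3) by fastforce
    then show ?thesis by (rule solve[OF pos_less(1)[OF a out'(1)] wv(2) insertI1 out[OF out'(1,2)]])
  next
    case inn': inn
    have "\<epsilon> (head Q a, c a) * sgn (int (head_pos a j) - int w) \<ge> 0"
      using sgn_head_pos_half[OF a inn'(1) wv(1)] inn'(3) by fastforce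
    then show ?thesis by (rule solve[OF wv(1) pos_less(2)[OF a inn'(1)] insertI2[OF singletonI] inn[OF inn'(1,2)]])
  qed
qed

section \<open>Representations near the up-and-down module\<close>

abbreviation "\<M> \<equiv> ud_module Q c \<beta> r \<epsilon>"

lemma ud_module_carrier: "\<M> \<in> rep_tuples Q \<beta>"
  by (auto simp: ud_module_def rep_tuples_def)

lemma ud_module_entry:
  assumes "a \<in> arcs Q" "w < \<beta> (head Q a)" "u < \<beta> (tail Q a)"
  shows "\<M> a $$ (w, u) = M_entry a w u"
proof -
  have "(\<exists>i. (a, i) \<in> arcs \<Gamma> \<and> tail \<Gamma> (a, i) = (tail Q a, u + 1) \<and> head \<Gamma> (a, i) = (head Q a, w + 1))
      \<longleftrightarrow> (\<exists>i<r a. w = head_pos a i \<and> u = tail_pos a i)"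
    using assms(1) by (auto simp: arcs_ud_graph ud_graph_ends)
  then show ?thesis using assms by (simp add: ud_module_def M_entry_def)
qed

text \<open>The image of \<open>M a\<close> is spanned by basis vectors at head positions of
  \<open>a\<close>, which \<open>M b\<close> kills because they are no tail positions of
  \<open>b\<close>. Each edge contributes one elementary matrix, which bounds the rank.\<close>

lemma ud_module_Rep: "(\<M> :: 'a \<Rightarrow> 'k::field mat) \<in> Rep Q c \<beta> r"
  (is "?M \<in> _")
  unfolding Rep_iff
proof (intro conjI ballI impI)
  show "?M \<in> rep_tuples Q \<beta>" by (rule ud_module_carrier)
next
  fix a b assume a: "a \<in> arcs Q" and b: "b \<in> arcs Q" and ab: "head Q a = tail Q b \<and> c a = c b"
  have ca: "?M a \<in> carrier_mat (\<beta> (head Q a)) (\<beta> (tail Q a))"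
    and cb: "?M b \<in> carrier_mat (\<beta> (head Q b)) (\<beta> (tail Q b))"
    using rep_tuplesD[OF ud_module_carrier] a b by blast+
  show "?M b * ?M a = 0\<^sub>m (\<beta> (head Q b)) (\<beta> (tail Q a))"
  proof (rule eq_matI)
    fix i j assume "i < dim_row (0\<^sub>m (\<beta> (head Q b)) (\<beta> (tail Q a)))"
      "j < dim_col (0\<^sub>m (\<beta> (head Q b)) (\<beta> (tail Q a)))"
    then have ij: "i < \<beta> (head Q b)" "j < \<beta> (tail Q a)" by auto
    have "(?M b * ?M a) $$ (i, j) = (\<Sum>u<\<beta> (head Q a). ?M b $$ (i, u) * ?M a $$ (u, j))"
      using ca cb ab ij by (simp add: scalar_prod_def atLeast0LessThan)
    also have "\<dots> = (\<Sum>u<\<beta> (head Q a). M_entry b i u * M_entry a u j)"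
      using ab ij a b by (intro sum.cong) (auto simp: ud_module_entry)
    also have "\<dots> = 0"
      using head_pos_neq_tail_pos[OF a b, THEN not_sym] ab
      by (intro sum.neutral) (auto simp: M_entry_def)
    finally show "(?M b * ?M a) $$ (i, j) = 0\<^sub>m (\<beta> (head Q b)) (\<beta> (tail Q a)) $$ (i, j)"
      using ij by simp
  qed (use ca cb in auto)
next
  fix a assume a: "a \<in> arcs Q"
  show "vec_space.rank (\<beta> (head Q a)) (?M a) \<le> r a"
  proof (rule vec_space.rank_le_if_factorization[OF rep_tuplesD[OF ud_module_carrier a]])
    fix w u assume wu: "w < \<beta> (head Q a)" "u < \<beta> (tail Q a)"
    show "?M a $$ (w, u) = (\<Sum>k<r a. (if w = head_pos a k then 1 else 0) * (if u = tail_pos a k then 1 else 0))"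
    proof (cases "\<exists>i<r a. w = head_pos a i \<and> u = tail_pos a i")
      case True
      then obtain i where i: "i < r a" "w = head_pos a i" "u = tail_pos a i" by blast
      have "(\<Sum>k<r a. (if w = head_pos a k then 1 else 0) * (if u = tail_pos a k then 1 else 0)) =
          (\<Sum>k<r a. if k = i then 1 else (0 :: 'k))"
        using i pos_inj[OF a i(1)] by (intro sum.cong) auto
      then show ?thesis using True i(1) wu a by (simp add: ud_module_entry M_entry_def)
    next
      case False
      have "(\<Sum>k<r a. (if w = head_pos a k then 1 else 0) * (if u = tail_pos a k then 1 else (0 :: 'k))) = 0"
        using False by (intro sum.neutral) auto
      then show ?thesis using False wu a by (simp add: ud_module_entry M_entry_def)
    qed
  qed
qed

section \<open>Homomorphisms from \<open>M\<close> to a varying representation\<close>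

definition rel_commutator ::
    "('a \<Rightarrow> 'k::field mat) \<Rightarrow> ('v \<Rightarrow> nat \<Rightarrow> nat \<Rightarrow> 'k) \<Rightarrow> 'a \<times> nat \<times> nat \<Rightarrow> 'k" where
  "rel_commutator N f = (\<lambda>(a, w, v). (\<Sum>u<\<beta> (tail Q a). N a $$ (w, u) * f (tail Q a) u v) -
     (\<Sum>u<\<beta> (head Q a). f (head Q a) w u * M_entry a u v))"

lemma rel_commutator_ud_module:
  assumes "e \<in> equations"
  shows "rel_commutator \<M> f e = commutator f e"
  using assms
  by (auto simp: rel_commutator_def commutator_def equations_def ud_module_entry)

lemma sum_mult_linear:
  fixes p :: "nat \<Rightarrow> 'k::comm_ring_1"
  shows "(\<Sum>u<m. p u * (s * f u - (\<Sum>l<n. g l u * y l))) =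
    s * (\<Sum>u<m. p u * f u) - (\<Sum>l<(n::nat). (\<Sum>u<m. p u * g l u) * y l)"
proof -
  have "(\<Sum>u<m. p u * (\<Sum>l<n. g l u * y l)) = (\<Sum>l<n. (\<Sum>u<m. p u * g l u) * y l)"
    by (simp add: sum_distrib_left sum_distrib_right mult.assoc) (rule sum.swap)
  then show ?thesis
    by (simp add: right_diff_distrib sum_subtractf sum_distrib_left mult.left_commute)
qed

text \<open>The combination has the form of a solution by Cramer's rule, with \<open>s\<close> the
  determinant and \<open>y l\<close> the numerators.\<close>

lemma rel_commutator_linear:
  "rel_commutator N (\<lambda>x u v. s * f x u v - (\<Sum>l<n. g l x u v * y l)) e =
    s * rel_commutator N f e - (\<Sum>l<(n::nat). rel_commutator N (g l) e * y l)"
proof -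
  obtain a w v where e: "e = (a, w, v)" by (cases e)
  have comm: "(\<Sum>u<m. f u * M_entry a u v) = (\<Sum>u<m. M_entry a u v * f u)" for m and f :: "nat \<Rightarrow> 'b"
    by (simp add: mult.commute)
  show ?thesis
    unfolding e rel_commutator_def prod.case comm sum_mult_linear
    by (simp add: right_diff_distrib left_diff_distrib sum_subtractf)
qed

lemma sum_M_entry:
  assumes "a \<in> arcs Q" "i < r a"
  shows "(\<Sum>u<\<beta> (head Q a). g u * M_entry a u (tail_pos a i)) = g (head_pos a i)"
proof -
  have "(\<Sum>u<\<beta> (head Q a). g u * M_entry a u (tail_pos a i)) =
      (\<Sum>u<\<beta> (head Q a). if u = head_pos a i then g (head_pos a i) else 0)"
    using pos_inj[OF assms] assms(2) by (intro sum.cong) (auto simp: M_entry_def)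
  then show ?thesis using pos_less[OF assms] by simp
qed

lemma sum_M_entry_half:
  assumes "v \<notin> tail_pos a ` {..<r a}"
  shows "(\<Sum>u<m. g u * M_entry a u v) = 0"
  using assms by (intro sum.neutral) (auto simp: M_entry_def)

text \<open>The block on the rows and columns occupied by edges of \<open>a\<close> is the identity
  at \<open>M\<close>. For \<open>N\<close> in \<open>Rep\<close>, a nonzero value forces
  \<open>N a\<close> to have rank exactly \<open>r a\<close>.\<close>

definition minor :: "('a \<Rightarrow> 'k::field mat) \<Rightarrow> 'a \<Rightarrow> 'k" where
  "minor N a = det (mat (r a) (r a) (\<lambda>(k, l). N a $$ (head_pos a k, tail_pos a l)))"

lemma minor_ud_module:
  assumes "a \<in> arcs Q"
  shows "minor \<M> a = (1 :: 'k::field)"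
proof -
  have "M_entry a (head_pos a k) (tail_pos a l) = (if k = l then 1 else 0 :: 'k)" if "k < r a" "l < r a" for k l
  proof -
    have "k = l" if "i < r a" "head_pos a k = head_pos a i" "tail_pos a l = tail_pos a i" for i
      using pos_inj(2)[OF assms \<open>k < r a\<close> that(1,2)] pos_inj(1)[OF assms \<open>l < r a\<close> that(1,3)] by simp
    then show ?thesis using that by (auto simp: M_entry_def)
  qed
  then have "mat (r a) (r a) (\<lambda>(k, l). \<M> a $$ (head_pos a k, tail_pos a l)) = (1\<^sub>m (r a) :: 'k mat)"
    using pos_less[OF assms] by (intro eq_matI) (auto simp: ud_module_entry[OF assms])
  then show ?thesis by (simp add: minor_def)
qed

text \<open>With \<open>\<phi> = N f - f M\<close>, the case of a basis vector in the kernel of \<open>M a\<close> holds because \<open>\<phi>\<close> maps it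
  into the image of \<open>N a\<close>; the remaining case then follows from \<open>N b \<phi> a + \<phi> b M a = 0\<close>.\<close>

lemma rel_commutator_eq_0:
  assumes N: "N \<in> Rep Q c \<beta> r" and minors: "\<And>a. a \<in> arcs Q \<Longrightarrow> minor N a \<noteq> (0 :: 'k::field)"
    and eqs: "\<And>e. e \<in> equations \<Longrightarrow> rel_commutator N f e = 0"
    and a: "a \<in> arcs Q" and w: "w < \<beta> (head Q a)" and v: "v < \<beta> (tail Q a)"
  shows "rel_commutator N f (a, w, v) = 0"
proof -
  note N_conj = N[unfolded Rep_iff]
  note Nc = N_conj[THEN conjunct1]
    and N_rel = N_conj[THEN conjunct2, THEN conjunct1, rule_format]
    and N_rank = N_conj[THEN conjunct2, THEN conjunct2, rule_format]
  have kernel: "rel_commutator N f (a, w, v) = 0"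
    if a: "a \<in> arcs Q" and w: "w < \<beta> (head Q a)" and v: "v < \<beta> (tail Q a)"
      and half: "v \<notin> tail_pos a ` {..<r a}" for a w v
  proof -
    have \<phi>: "rel_commutator N f (a, w, v) = (\<Sum>u<\<beta> (tail Q a). N a $$ (w, u) * f (tail Q a) u v)" for w
      by (simp add: rel_commutator_def sum_M_entry_half[OF half])
    \<comment> \<open>The rows at head positions of \<open>a\<close> belong to
      \<open>equations\<close>; the minor of \<open>N a\<close> extends the vanishing from them to
      all rows.\<close>
    have "(\<Sum>u<\<beta> (tail Q a). N a $$ (head_pos a k, u) * f (tail Q a) u v) = 0" if "k < r a" for k
    proof -
      have "(a, head_pos a k, v) \<in> equations"
        using a v that pos_less[OF a that] head_pos_neq_tail_pos[OF a] by (auto simp: equations_def)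
      then show ?thesis using eqs \<phi> by metis
    qed
    note zero = this
    show ?thesis
      unfolding \<phi>
    proof (rule column_eq_0_if_minor_nonzero[OF rep_tuplesD[OF Nc a] N_rank[OF a]])
      show "det (mat (r a) (r a) (\<lambda>(k, l). N a $$ (head_pos a k, tail_pos a l))) \<noteq> 0"
        using minors[OF a] by (simp add: minor_def)
    qed (use pos_less[OF a] zero w in auto)
  qed
  show ?thesis
  proof (cases "v \<in> tail_pos a ` {..<r a}")
    case True
    then obtain i where i: "i < r a" "v = tail_pos a i" by auto
    show ?thesis
    proof (cases "\<exists>b\<in>arcs Q. tail Q b = head Q a \<and> c b = c a \<and> w \<in> tail_pos b ` {..<r b}")
      case False
      then have "(a, w, v) \<in> equations" using a w v True by (auto simp: equations_def)
      then show ?thesis by (rule eqs)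
    next
      case True
      then obtain b where b: "b \<in> arcs Q" "tail Q b = head Q a" "c b = c a" by blast
      let ?z = "\<lambda>j. rel_commutator N f (a, j, v)"
      have z: "?z j = (\<Sum>u<\<beta> (tail Q a). N a $$ (j, u) * f (tail Q a) u v) - f (head Q a) j (head_pos a i)" for j
        by (simp add: rel_commutator_def i(2) sum_M_entry[OF a i(1)])
      have head_half: "head_pos a i \<notin> tail_pos b ` {..<r b}"
        using head_pos_neq_tail_pos[OF a b(1) _ _ i(1)] b by auto
      \<comment> \<open>\<open>N b * N a = 0\<close> removes the first part of \<open>?z\<close>.
        The second is removed by the kernel case for \<open>b\<close>, since \<open>M b\<close>
        kills the basis vector at \<open>head_pos a i\<close>.\<close>
      have "(\<Sum>j<\<beta> (head Q a). N b $$ (y, j) * ?z j) = 0" if y: "y < \<beta> (head Q b)" for y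
      proof -
        have "(\<Sum>j<\<beta> (head Q a). N b $$ (y, j) * (\<Sum>u<\<beta> (tail Q a). N a $$ (j, u) * f (tail Q a) u v)) =
            (\<Sum>u<\<beta> (tail Q a). (\<Sum>j<\<beta> (head Q a). N b $$ (y, j) * N a $$ (j, u)) * f (tail Q a) u v)"
          by (simp add: sum_distrib_left sum_distrib_right mult.assoc) (rule sum.swap)
        also have "\<dots> = (\<Sum>u<\<beta> (tail Q a). (N b * N a) $$ (y, u) * f (tail Q a) u v)"
          using rep_tuplesD[OF Nc a] rep_tuplesD[OF Nc b(1)] y b(2)
          by (intro sum.cong) (auto simp: scalar_prod_def atLeast0LessThan)
        also have "N b * N a = 0\<^sub>m (\<beta> (head Q b)) (\<beta> (tail Q a))"
          using b by (intro N_rel[OF a b(1)]) simp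
        finally have 0: "(\<Sum>j<\<beta> (head Q a). N b $$ (y, j) *
            (\<Sum>u<\<beta> (tail Q a). N a $$ (j, u) * f (tail Q a) u v)) = 0" using y by simp
        have "rel_commutator N f (b, y, head_pos a i) = 0"
          using kernel[OF b(1) y _ head_half] pos_less(2)[OF a i(1)] b(2) by simp
        then have "(\<Sum>j<\<beta> (head Q a). N b $$ (y, j) * f (head Q a) j (head_pos a i)) = 0"
          by (simp add: rel_commutator_def sum_M_entry_half[OF head_half] b(2))
        then show ?thesis using 0 by (simp add: z right_diff_distrib sum_subtractf)
      qed
      then have zero: "(\<Sum>j<\<beta> (head Q a). N b $$ (head_pos b k, j) * ?z j) = 0" if "k < r b" for k
        using pos_less(2)[OF b(1) that] by simp
      \<comment> \<open>\<open>b\<close> is the only arrow of its color leaving this vertex, so off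
        its tail positions the entries belong to \<open>equations\<close>. On the remaining
        positions the nonzero minor makes \<open>N b\<close> injective.\<close>
      have supp: "?z j = 0" if "j < \<beta> (head Q a)" "j \<notin> tail_pos b ` {..<r b}" for j
      proof -
        have "j \<notin> tail_pos b' ` {..<r b'}" if "b' \<in> arcs Q" "tail Q b' = head Q a" "c b' = c a" for b'
          using out_unique[OF b(1) that(1)] b that \<open>j \<notin> tail_pos b ` {..<r b}\<close> by metis
        then have "(a, j, v) \<in> equations" using a v that(1) i by (auto simp: equations_def)
        then show ?thesis by (rule eqs)
      qed
      have "inj_on (tail_pos b) {..<r b}" using pos_inj(1)[OF b(1)] by (auto simp: inj_on_def)
      then show ?thesis
        using eq_0_if_minor_nonzero[OF _ _ minors[OF b(1), unfolded minor_def] supp zero w]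
          pos_less(1)[OF b(1)] b(2) by metis
    qed
  qed (rule kernel[OF a w v])
qed

section \<open>Polynomial dependence and Cramer's rule\<close>

lemma finite_equations: "finite equations"
proof -
  have "equations \<subseteq> (SIGMA a:arcs Q. {..<\<beta> (head Q a)} \<times> {..<\<beta> (tail Q a)})"
    by (auto simp: equations_def)
  then show ?thesis by (rule finite_subset) auto
qed

lemma rep_polynomial_rel_commutator:
  assumes "e \<in> equations"
  shows "rep_polynomial Q \<beta> (\<lambda>N. rel_commutator N f e)"
proof -
  obtain a w v where e: "e = (a, w, v)" by (cases e)
  then have "a \<in> arcs Q" "w < \<beta> (head Q a)" using assms by (auto simp: equations_def)
  then show ?thesis
    unfolding e rel_commutator_def
    by (auto intro!: rep_polynomial_diff rep_polynomial_sum rep_polynomial.intros)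
qed

lemma rep_polynomial_minor:
  assumes "a \<in> arcs Q"
  shows "rep_polynomial Q \<beta> (\<lambda>N. minor N a)"
  unfolding minor_def
proof (rule rep_polynomial_det)
  fix k l assume "k < r a" "l < r a"
  then show "rep_polynomial Q \<beta> (\<lambda>N. mat (r a) (r a) (\<lambda>(k, l). N a $$ (head_pos a k, tail_pos a l)) $$ (k, l))"
    using rep_polynomial.coord[OF assms pos_less(2)[OF assms] pos_less(1)[OF assms]] by simp
qed simp

text \<open>The nonzero determinants make the matrices of \<open>f\<close> an element of
  \<open>GL\<close>, and commuting with the arrows means that it carries \<open>M\<close> to
  \<open>N\<close>.\<close>

lemma isomorphism_in_orbit:
  assumes N: "(N :: 'a \<Rightarrow> 'k::field mat) \<in> rep_tuples Q \<beta>"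
    and comm: "\<And>a w v. a \<in> arcs Q \<Longrightarrow> w < \<beta> (head Q a) \<Longrightarrow> v < \<beta> (tail Q a) \<Longrightarrow>
      rel_commutator N f (a, w, v) = 0"
    and det: "\<And>x. x \<in> verts Q \<Longrightarrow> det (mat (\<beta> x) (\<beta> x) (\<lambda>(u, v). f x u v)) \<noteq> 0"
  shows "N \<in> GL_orbit Q \<beta> \<M>"
    (is "_ \<in> GL_orbit _ _ ?M")
proof -
  define g where "g = (\<lambda>x\<in>verts Q. mat (\<beta> x) (\<beta> x) (\<lambda>(u, v). f x u v))"
  have g: "g \<in> GL Q \<beta>" using det by (auto simp: GL_iff g_def)
  have "N a * g (tail Q a) = g (head Q a) * ?M a" if a: "a \<in> arcs Q" for a
  proof -
    have ca: "N a \<in> carrier_mat (\<beta> (head Q a)) (\<beta> (tail Q a))"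
        "?M a \<in> carrier_mat (\<beta> (head Q a)) (\<beta> (tail Q a))"
      using rep_tuplesD[OF N a] rep_tuplesD[OF ud_module_carrier a] by blast+
    show ?thesis
    proof (rule eq_matI)
      fix w v assume "w < dim_row (g (head Q a) * ?M a)" "v < dim_col (g (head Q a) * ?M a)"
      then have wv: "w < \<beta> (head Q a)" "v < \<beta> (tail Q a)" using ca a by (auto simp: g_def)
      have "(N a * g (tail Q a)) $$ (w, v) = (\<Sum>u<\<beta> (tail Q a). N a $$ (w, u) * f (tail Q a) u v)"
        using ca wv a by (simp add: g_def scalar_prod_def atLeast0LessThan)
      also have "\<dots> = (\<Sum>u<\<beta> (head Q a). f (head Q a) w u * M_entry a u v)"
        using comm[OF a wv] by (simp add: rel_commutator_def)
      also have "\<dots> = (g (head Q a) * ?M a) $$ (w, v)"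
        using ca wv a by (simp add: g_def scalar_prod_def atLeast0LessThan ud_module_entry)
      finally show "(N a * g (tail Q a)) $$ (w, v) = (g (head Q a) * ?M a) $$ (w, v)" .
    next
      show "dim_row (N a * g (tail Q a)) = dim_row (g (head Q a) * ?M a)"
        "dim_col (N a * g (tail Q a)) = dim_col (g (head Q a) * ?M a)"
        using ca a by (auto simp: g_def)
    qed
  qed
  then have "GL_act Q g ?M = N" using GL_act_eq_iff[OF g ud_module_carrier N] by blast
  then show ?thesis using g by (auto simp: GL_orbit_def)
qed

text \<open>Cramer's rule extends the identity of \<open>M\<close> to a family of solutions \<open>f : M \<rightarrow> N\<close> of the equations,
  polynomial in \<open>N\<close>.\<close>

lemma homomorphism_family:
  assumes "no_bands \<Gamma>"
  obtains F :: "('a \<Rightarrow> 'k::field mat) \<Rightarrow> 'v \<Rightarrow> nat \<Rightarrow> nat \<Rightarrow> 'k"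
  where "\<And>N e. e \<in> equations \<Longrightarrow> rel_commutator N (F N) e = 0"
    and "\<And>x u v. F \<M> x u v = (if u = v then 1 else 0)"
    and "\<And>x u v. rep_polynomial Q \<beta> (\<lambda>N. F N x u v)"
proof -
  obtain es where es: "set es = equations" "distinct es"
    using finite_distinct_list[OF finite_equations] by blast
  define n where "n = length es"
  have es_in: "es ! k \<in> equations" if "k < n" for k
    using that es(1) nth_mem by (auto simp: n_def)
  have "\<forall>e0. \<exists>f. e0 \<in> equations \<longrightarrow>
      (\<forall>e\<in>equations. commutator f e = (if e = e0 then 1 else (0 :: 'k)))"
    using commutator_right_inverse[OF assms] by blast
  then obtain R where R: "\<And>e0 e. e0 \<in> equations \<Longrightarrow> e \<in> equations \<Longrightarrow>
      commutator (R e0) e = (if e = e0 then 1 else (0 :: 'k))" by metis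
  \<comment> \<open>These families are dual to the equations at \<open>M\<close>. Correcting the
    identity by their combinations gives a square system, with matrix \<open>A N\<close>.\<close>
  define g where "g l = R (es ! l)" for l
  define \<iota> :: "'v \<Rightarrow> nat \<Rightarrow> nat \<Rightarrow> 'k" where "\<iota> x u v = (if u = v then 1 else 0)" for x u v
  define A where "A N = mat n n (\<lambda>(k, l). rel_commutator N (g l) (es ! k))" for N
  \<comment> \<open>The adjugate is applied to the error of the identity family
    \<open>\<iota>\<close>. Scaling by \<open>det (A N)\<close> instead of dividing by it keeps
    \<open>F\<close> polynomial and defined for every \<open>N\<close>.\<close>
  define y where "y N l = (\<Sum>k<n. adj_mat (A N) $$ (l, k) * rel_commutator N \<iota> (es ! k))" for N l
  define F where "F N x u v = det (A N) * \<iota> x u v - (\<Sum>l<n. g l x u v * y N l)" for N x u v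
  have A: "A N \<in> carrier_mat n n" for N by (simp add: A_def)
  note adj = adj_mat[OF A]
  have zero: "rel_commutator N (F N) e = 0" if e: "e \<in> equations" for N e
  proof -
    obtain m where m: "m < n" "e = es ! m" using e es(1) by (metis in_set_conv_nth n_def)
    have "(\<Sum>l<n. rel_commutator N (g l) e * y N l) =
        (\<Sum>k<n. (\<Sum>l<n. A N $$ (m, l) * adj_mat (A N) $$ (l, k)) * rel_commutator N \<iota> (es ! k))"
      using m by (simp add: y_def A_def sum_distrib_left sum_distrib_right mult.assoc) (rule sum.swap)
    also have "\<dots> = (\<Sum>k<n. (A N * adj_mat (A N)) $$ (m, k) * rel_commutator N \<iota> (es ! k))"
      using m(1) A[of N] adj(1)[of N]
      by (intro sum.cong) (auto simp: scalar_prod_def atLeast0LessThan)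
    also have "\<dots> = (\<Sum>k<n. if k = m then det (A N) * rel_commutator N \<iota> e else 0)"
      using m by (intro sum.cong) (auto simp: adj(2))
    also have "\<dots> = det (A N) * rel_commutator N \<iota> e" using m(1) by simp
    finally show ?thesis unfolding F_def rel_commutator_linear by simp
  qed
  have "A \<M> = 1\<^sub>m n"
    using es(2) es_in
    by (intro eq_matI) (auto simp: A_def rel_commutator_ud_module g_def R nth_eq_iff_index_eq n_def)
  \<comment> \<open>The identity commutes with \<open>M\<close>, so no correction is made
    there.\<close>
  moreover have "rel_commutator \<M> \<iota> e = 0" if "e \<in> equations" for e
  proof -
    obtain a w v where e: "e = (a, w, v)" by (cases e)
    have wv: "w < \<beta> (head Q a)" "v < \<beta> (tail Q a)" using that e by (auto simp: equations_def)
    have "(\<Sum>u<\<beta> (tail Q a). M_entry a w u * \<iota> (tail Q a) u v) =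
        (\<Sum>u<\<beta> (tail Q a). if u = v then M_entry a w v else 0)"
      "(\<Sum>u<\<beta> (head Q a). \<iota> (head Q a) w u * M_entry a u v) =
        (\<Sum>u<\<beta> (head Q a). if u = w then M_entry a w v else 0)"
      by (intro sum.cong; simp add: \<iota>_def)+
    then show ?thesis
      unfolding rel_commutator_ud_module[OF that] using wv by (simp add: e commutator_def)
  qed
  ultimately have at_M: "F \<M> x u v = (if u = v then 1 else 0)" for x u v
    using es_in by (simp add: F_def y_def \<iota>_def)
  have polyA: "rep_polynomial Q \<beta> (\<lambda>N. A N $$ (k, l))" if "k < n" "l < n" for k l
    using that by (simp add: A_def rep_polynomial_rel_commutator es_in)
  have poly: "rep_polynomial Q \<beta> (\<lambda>N. F N x u v)" for x u v
    unfolding F_def y_def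
    by (intro rep_polynomial_diff rep_polynomial_sum rep_polynomial.mult rep_polynomial.const
        rep_polynomial_det[OF A] rep_polynomial_adj_mat[OF A] rep_polynomial_rel_commutator
        polyA es_in) auto
  show thesis using that[of F] zero at_M poly by blast
qed

text \<open>Nonzero minors let the solved equations imply the remaining ones, and nonzero
  determinants make the resulting homomorphism invertible. Every factor of \<open>h\<close> equals 1
  at \<open>M\<close>.\<close>

theorem zariski_open_GL_orbit_ud_module:
  assumes "no_bands \<Gamma>"
  shows "zariski_open_in Q \<beta> (Rep Q c \<beta> r) (GL_orbit Q \<beta> (\<M> :: 'a \<Rightarrow> 'k::field mat))"
proof -
  obtain F :: "('a \<Rightarrow> 'k mat) \<Rightarrow> 'v \<Rightarrow> nat \<Rightarrow> nat \<Rightarrow> 'k" where F: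
    "\<And>N e. e \<in> equations \<Longrightarrow> rel_commutator N (F N) e = 0"
    "\<And>x u v. F \<M> x u v = (if u = v then 1 else 0)"
    "\<And>x u v. rep_polynomial Q \<beta> (\<lambda>N. F N x u v)"
    using homomorphism_family[OF assms] by blast
  let ?det = "\<lambda>N x. det (mat (\<beta> x) (\<beta> x) (\<lambda>(u, v). F N x u v))"
  define h where "h N = (\<Prod>a\<in>arcs Q. minor N a) * (\<Prod>x\<in>verts Q. ?det N x)" for N
  show ?thesis
  proof (rule zariski_open_GL_orbit[OF fin_digraph_axioms ud_module_Rep])
    show "rep_polynomial Q \<beta> h"
      unfolding h_def
      by (intro rep_polynomial.mult rep_polynomial_prod rep_polynomial_minor rep_polynomial_det)
        (auto simp: F(3))
    have "mat (\<beta> x) (\<beta> x) (\<lambda>(u, v). F \<M> x u v) = 1\<^sub>m (\<beta> x)" for x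
      by (intro eq_matI) (auto simp: F(2))
    then show "h \<M> \<noteq> 0" by (simp add: h_def minor_ud_module)
    fix N assume N: "N \<in> Rep Q c \<beta> r" and hN: "h N \<noteq> 0"
    then have minors: "\<And>a. a \<in> arcs Q \<Longrightarrow> minor N a \<noteq> 0" and det: "\<And>x. x \<in> verts Q \<Longrightarrow> ?det N x \<noteq> 0"
      by (auto simp: h_def)
    show "N \<in> GL_orbit Q \<beta> \<M>"
      using N Rep_iff rel_commutator_eq_0[OF N minors F(1)] det
      by (intro isomorphism_in_orbit[of N "F N"]) auto
  qed
qed

end

section \<open>Gentle string algebras\<close>

lemma (in pre_digraph) cas_consecutive:
  assumes "cas x p y" "Suc i < length p"
  shows "head G (p ! i) = tail G (p ! Suc i)"
  using assms
proof (induction p arbitrary: x i)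
  case (Cons a p)
  then show ?case by (cases i; cases p) auto
qed simp

lemma path2_in_color_ideal:
  assumes "a \<in> arcs Q" "b \<in> arcs Q" "head Q a = tail Q b" "c a = c b"
  shows "path2 Q a b \<in> color_ideal Q c"
  unfolding color_ideal_def using assms by (intro path_ideal.gen) blast

text \<open>Along the path formed by a color, all arrows but the last have a successor and all but the first
  have a predecessor, so condition (iii) separates the arrows of that color at a vertex.\<close>

lemma arrows_of_color_at_vertex:
  assumes "coloring Q S c"
    and gentle: "gentle_string_algebra Q (color_ideal Q c :: ('v, 'a, 'k::field) path_alg set)"
    and ab: "a \<in> arcs Q" "b \<in> arcs Q" "c a = c b"
  shows "head Q a = head Q b \<Longrightarrow> a = b" and "tail Q a = tail Q b \<Longrightarrow> a = b"
proof -
  let ?I = "color_ideal Q c :: ('v, 'a, 'k) path_alg set"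
  have "c a \<in> S" using assms(1) ab(1) by (auto simp: coloring_def)
  then obtain x p y where "pre_digraph.awalk Q x p y" and p: "set p = {d \<in> arcs Q. c d = c a}"
    using assms(1) unfolding coloring_def by blast
  then have cas: "pre_digraph.cas Q x p y" by (simp add: pre_digraph.awalk_def)
  have p_in: "p ! i \<in> arcs Q" "c (p ! i) = c a" if "i < length p" for i
    using nth_mem[OF that] p by auto
  have succ: "head Q (p ! i) = tail Q (p ! Suc i)" if "Suc i < length p" for i
    by (rule pre_digraph.cas_consecutive[OF cas that])
  obtain i j where i: "i < length p" "p ! i = a" and j: "j < length p" "p ! j = b"
    using p ab by (metis (mono_tags, lifting) in_set_conv_nth mem_Collect_eq)
  \<comment> \<open>Two arrows into the tail of \<open>d\<close> with the color of \<open>d\<close>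
    both compose with \<open>d\<close> to a path in the ideal.\<close>
  have head_unique: "d1 = d2"
    if "d1 \<in> arcs Q" "d2 \<in> arcs Q" "d \<in> arcs Q" "head Q d1 = tail Q d" "head Q d2 = tail Q d"
      "c d1 = c d" "c d2 = c d" for d d1 d2
  proof -
    have "\<exists>\<^sub>\<le>\<^sub>1d'. d' \<in> arcs Q \<and> head Q d' = tail Q d \<and> path2 Q d' d \<in> ?I"
      using gentle that(3) unfolding gentle_string_algebra_def by blast
    then show ?thesis by (rule Uniq_D) (use that in \<open>auto intro: path2_in_color_ideal\<close>)
  qed
  have tail_unique: "d1 = d2"
    if "d1 \<in> arcs Q" "d2 \<in> arcs Q" "d \<in> arcs Q" "tail Q d1 = head Q d" "tail Q d2 = head Q d"
      "c d1 = c d" "c d2 = c d" for d d1 d2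
  proof -
    have "\<exists>\<^sub>\<le>\<^sub>1d'. d' \<in> arcs Q \<and> tail Q d' = head Q d \<and> path2 Q d d' \<in> ?I"
      using gentle that(3) unfolding gentle_string_algebra_def by blast
    then show ?thesis by (rule Uniq_D) (use that in \<open>auto intro!: path2_in_color_ideal\<close>)
  qed
  \<comment> \<open>If the positions differ, the earlier arrow has a successor on the path and the
    later one a predecessor.\<close>
  consider "i = j" | "Suc i < length p \<and> 0 < j" | "Suc j < length p \<and> 0 < i"
    using i(1) j(1) by linarith
  note cases = this
  show "a = b" if "head Q a = head Q b"
    using cases
  proof cases
    case 2
    then show ?thesis
      using head_unique[OF ab(1,2) p_in(1)] p_in(2) succ[of i] i(2) ab(3) that by metis
  next
    case 3
    then show ?thesis
      using head_unique[OF ab(1,2) p_in(1)] p_in(2) succ[of j] j(2) ab(3) that by metis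
  qed (use i j in simp)
  show "a = b" if "tail Q a = tail Q b"
    using cases
  proof cases
    case 2
    then show ?thesis
      using tail_unique[OF ab(1,2) p_in(1)[of "j - 1"]] p_in(2)[of "j - 1"] succ[of "j - 1"] j ab(3) that
      by simp
  next
    case 3
    then show ?thesis
      using tail_unique[OF ab(1,2) p_in(1)[of "i - 1"]] p_in(2)[of "i - 1"] succ[of "i - 1"] i ab(3) that
      by simp
  qed (use i j in simp)
qed

lemma up_and_downI:
  assumes "fin_digraph Q" and coloring: "coloring Q S c"
    and gentle: "gentle_string_algebra Q (color_ideal Q c :: ('v, 'a, 'k::field) path_alg set)"
    and rank: "rank_map Q c \<beta> r" and sign: "sign_function Q S c \<epsilon>"
  shows "up_and_down Q c \<beta> r \<epsilon>"
proof -
  interpret fin_digraph Q by fact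
  have incident: "(x, c a) \<in> color_incidences Q S c" if "a \<in> arcs Q" "x \<in> {tail Q a, head Q a}" for a x
    using that coloring by (auto simp: color_incidences_def coloring_def)
  show ?thesis
  proof unfold_locales
    fix a b x assume a: "a \<in> arcs Q"
    show "r a \<le> \<beta> (tail Q a)" "r a \<le> \<beta> (head Q a)" using rank a by (auto simp: rank_map_def)
    show "\<epsilon> (x, c a) = 1 \<or> \<epsilon> (x, c a) = - 1" if "x \<in> {tail Q a, head Q a}"
      using sign incident[OF a that] by (auto simp: sign_function_def)
    assume b: "b \<in> arcs Q"
    show "head Q a = head Q b \<Longrightarrow> c a = c b \<Longrightarrow> a = b" "tail Q a = tail Q b \<Longrightarrow> c a = c b \<Longrightarrow> a = b"
      using arrows_of_color_at_vertex[OF coloring gentle a b] by blast+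
    show "head Q a = tail Q b \<Longrightarrow> c a = c b \<Longrightarrow> r a + r b \<le> \<beta> (head Q a)"
      using rank a b by (auto simp: rank_map_def)
    show "x \<in> {tail Q a, head Q a} \<Longrightarrow> x \<in> {tail Q b, head Q b} \<Longrightarrow> c a \<noteq> c b \<Longrightarrow>
        \<epsilon> (x, c a) = - \<epsilon> (x, c b)"
      using sign incident[OF a] incident[OF b] unfolding sign_function_def by blast
  qed
qed

theorem corollary3p6:
  fixes Q :: "('v, 'a) pre_digraph"
    and S :: "'s set"
    and c :: "'a \<Rightarrow> 's"
    and \<beta> :: "'v \<Rightarrow> nat"
    and r :: "'a \<Rightarrow> nat"
    and \<epsilon> :: "'v \<times> 's \<Rightarrow> int"
  assumes "fin_digraph Q"
    and "coloring Q S c"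
    and "gentle_string_algebra Q
           (color_ideal Q c :: ('v, 'a, 'k::alg_closed_field) path_alg set)"
    and "maximal_rank_map Q c \<beta> r"
    and "sign_function Q S c \<epsilon>"
    and "no_bands (ud_graph Q c \<beta> r \<epsilon>)"
  shows "zariski_open_in Q \<beta> (Rep Q c \<beta> r)
           (GL_orbit Q \<beta> (ud_module Q c \<beta> r \<epsilon> :: 'a \<Rightarrow> 'k mat))"
proof -
  interpret up_and_down Q c \<beta> r \<epsilon>
    using assms(4) by (intro up_and_downI[OF assms(1-3) _ assms(5)]) (simp add: maximal_rank_map_def)
  show ?thesis by (rule zariski_open_GL_orbit_ud_module[OF assms(6)])
qed

end
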